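(* (a) If $f\in C^3[0,1]$ and $f'''\geq 0$ in $[0,1]$, then for all integers $n\geq 2$, $$0\leq R\big[Q_{n+1}^{R,l};f\big]\leq \frac{\sqrt{3}}{108n^3}\big(f''(1)-f''(0)\big),$$ $$0\geq R\big[Q_{n+1}^{R,r};f\big]\geq \frac{\sqrt{3}}{108n^3}\big(f''(0)-f''(1)\big),$$ where $Q_{n+1}^{R,l}$ and $Q_{n+1}^{R,r}$ are the $(n+1)$-point left and right Radau quadrature formulae associated with the spline space $S_{n,3}$. (b) If $f\in C^4[0,1]$ and $f^{(4)}\geq 0$ in $[0,1]$, then for all integers $n\geq 2$, $$0\leq R\big[Q_{n+1}^{G};f\big]\leq \frac{1}{384n^4}\big(f'''(1)-f'''(0)\big),$$ where $Q_{n+1}^{G}$ is the $(n+1)$-point Gauss quadrature formula associated with the spline space $S_{n,4}$.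
   Context: Notation. $I[f]=\int_0^1 f(x)\,dx$. A quadrature formula is a linear functional $Q[f]=\sum_{i=1}^{m}a_i f(\tau_i)$ with real weights $a_i$ and nodes $0\le\tau_1<\dots<\tau_m\le 1$ (an $m$-point formula); its remainder is $R[Q;f]=I[f]-Q[f]$. Spline spaces. For $n\ge 2$, $r\in\{3,4\}$ and $x_k=k/n$, $k=0,\dots,n$, $S_{n,r}$ is the linear space of all $f\in C^{r-3}[0,1]$ whose restriction to each $(x_k,x_{k+1})$, $k=0,\dots,n-1$, is a polynomial of degree at most $r-1$. Radau formulae. The right Radau formula $Q_{n+1}^{R,r}$ associated with $S_{n,3}$ is the unique $(n+1)$-point quadrature formula of the form $\sum_{k=0}^{n-1}a_{k,n}f(\tau_{k,n})+a_{n,n}f(1)$ with $0<\tau_{0,n}<\dots<\tau_{n-1,n}<1$ and $R[Q_{n+1}^{R,r};f]=0$ for all $f\in S_{n,3}$. It is known explicitly: $\tau_{k,n}=(k+\theta_k)/n$ and $a_{k,n}=\frac{1}{6n\theta_k(1-\theta_k)}$ for $k=0,\dots,n-1$, and $a_{n,n}=\frac{2-3\theta_{n-1}}{6n(1-\theta_{n-1})}$, where $\theta_0=1/3$ and $\theta_k=\frac{1-\theta_{k-1}}{5-6\theta_{k-1}}$ for $k\ge1$. The left Radau formula $Q_{n+1}^{R,l}$ is its reflection, $Q_{n+1}^{R,l}[f]=Q_{n+1}^{R,r}[f(1-\cdot)]$. Gauss formula. $Q_{n+1}^{G}$ is the quadrature formula $\sum_{i=1}^{n+1}a_{i}f(\tau_{i})$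 with $0<\tau_1<\dots<\tau_{n+1}<1$ determined uniquely by the property $Q_{n+1}^G[f]=I[f]$ for every $f\in S_{n,4}$ (it is known to exist, to be unique, and to have positive weights). *)

theory Defs
  imports "HOL-Analysis.Analysis" "HOL-Computational_Algebra.Polynomial"
begin

text \<open>
  Functions on \<open>[0,1]\<close> are represented by total functions on the reals of which only the
  values on \<open>{0..1}\<close> matter.  Accordingly derivatives are taken within \<open>{0..1}\<close>, so that
  they are one-sided at the two endpoints.
\<close>

primrec deriv01 :: "nat \<Rightarrow> (real \<Rightarrow> real) \<Rightarrow> real \<Rightarrow> real" where
  "deriv01 0 f = f"
| "deriv01 (Suc k) f = (\<lambda>x. vector_derivative (deriv01 k f) (at x within {0..1}))"

definition C01 :: "nat \<Rightarrow> (real \<Rightarrow> real) set" where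
  "C01 k = {f. (\<forall>j<k. deriv01 j f differentiable_on {0..1}) \<and>
               continuous_on {0..1} (deriv01 k f)}"

text \<open>Only \<open>r = 3\<close> and \<open>r = 4\<close> are used, so the subtractions do not truncate.\<close>

definition spline_space :: "nat \<Rightarrow> nat \<Rightarrow> (real \<Rightarrow> real) set" where
  "spline_space n r = {f \<in> C01 (r - 3).
     \<forall>k<n. \<exists>p::real poly. degree p \<le> r - 1 \<and>
       (\<forall>x\<in>{real k / real n <..< real (k + 1) / real n}. f x = poly p x)}"

definition remainder :: "((real \<Rightarrow> real) \<Rightarrow> real) \<Rightarrow> (real \<Rightarrow> real) \<Rightarrow> real" where
  "remainder Q f = integral {0..1} f - Q f"

text \<open>
  The Radau and Gauss formulae are given by their defining properties, as predicates on
  quadrature functionals.  These properties are known to determine the formulae uniquely.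
\<close>

definition is_right_radau :: "nat \<Rightarrow> ((real \<Rightarrow> real) \<Rightarrow> real) \<Rightarrow> bool" where
  "is_right_radau n Q \<longleftrightarrow>
     (\<exists>a \<tau> :: nat \<Rightarrow> real.
        (\<forall>k<n. 0 < \<tau> k \<and> \<tau> k < 1) \<and> strict_mono_on {..<n} \<tau> \<and>
        Q = (\<lambda>f. (\<Sum>k<n. a k * f (\<tau> k)) + a n * f 1)) \<and>
     (\<forall>f\<in>spline_space n 3. remainder Q f = 0)"

definition is_left_radau :: "nat \<Rightarrow> ((real \<Rightarrow> real) \<Rightarrow> real) \<Rightarrow> bool" where
  "is_left_radau n Q \<longleftrightarrow>
     (\<exists>Q'. is_right_radau n Q' \<and> Q = (\<lambda>f. Q' (\<lambda>x. f (1 - x))))"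

definition is_gauss :: "nat \<Rightarrow> ((real \<Rightarrow> real) \<Rightarrow> real) \<Rightarrow> bool" where
  "is_gauss n Q \<longleftrightarrow>
     (\<exists>a \<tau> :: nat \<Rightarrow> real.
        (\<forall>i\<in>{1..n+1}. 0 < \<tau> i \<and> \<tau> i < 1) \<and> strict_mono_on {1..n+1} \<tau> \<and>
        Q = (\<lambda>f. \<Sum>i=1..n+1. a i * f (\<tau> i))) \<and>
     (\<forall>f\<in>spline_space n 4. remainder Q f = 0)"

end

theory Submission
  imports Defs
begin

text \<open>
  The remainder of a rule that is exact on polynomials of degree at most \<open>r - 1\<close> is the integral of
  the \<open>r\<close>-th derivative against a Peano kernel, which up to sign is a monospline of degree \<open>r\<close>.
  Exactness on splines gives the kernel a double zero at every knot \<open>k/n\<close>, so it suffices to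
  bound the kernel between consecutive knots.

  For \<open>r = 3\<close> the double zeros leave room for exactly one node in each cell, and its position is
  determined by the second derivative of the kernel at the left end of the cell. After scaling,
  these second derivatives follow \<open>c \<mapsto> (1 + 4c)/(4 + 12c)\<close> from \<open>c = 0\<close>, hence never exceed the fixed
  point \<open>\<surd>3/6\<close>, for which the maximum of the kernel is \<open>\<surd>3/108\<close>.

  For \<open>r = 4\<close> Rolle's theorem gives two zeros of the second derivative of the kernel in each cell.
  That derivative is strictly convex away from nodes of positive weight, so alternate zeros are
  separated by such a node. This needs all \<open>n + 1\<close> nodes, whence every weight is positive, and a
  negative value of the kernel would need one node more. Finally the kernel equals its own Hermite
  interpolation error at the ends of a cell, and with positive weights this is at most the error
  \<open>h\<^sup>4 s\<^sup>2 (1 - s)\<^sup>2 / 24\<close> for \<open>t\<^sup>4/24\<close>, where \<open>h = 1/n\<close>.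
\<close>

section \<open>Monosplines and the Peano kernel\<close>

text \<open>The degree is \<open>Suc m\<close> and the nodes are the knots. The factorials make each
  of these functions, for \<open>m \<ge> 1\<close>, the derivative of the next one up with the same
  \<open>a\<close> and \<open>\<tau>\<close>.\<close>

definition monospline :: "nat \<Rightarrow> 'i set \<Rightarrow> ('i \<Rightarrow> real) \<Rightarrow> ('i \<Rightarrow> real) \<Rightarrow> real \<Rightarrow> real" where
  "monospline m I a \<tau> t =
     t ^ Suc m / fact (Suc m) - (\<Sum>i\<in>I. a i * max 0 (t - \<tau> i) ^ m) / fact m"

lemma truncated_power_derivative:
  fixes c x :: real
  assumes "m \<ge> 1"
  shows "((\<lambda>x. max 0 (x - c) ^ Suc m) has_real_derivative real (Suc m) * max 0 (x - c) ^ m) (at x)"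
proof -
  consider "x < c" | "x = c" | "x > c" by linarith
  then show ?thesis
  proof cases
    case 1
    have "((\<lambda>x. 0) has_real_derivative 0) (at x)" by simp
    then have "((\<lambda>x. max 0 (x - c) ^ Suc m) has_real_derivative 0) (at x)"
      by (rule has_field_derivative_transform_within_open[where S = "{..<c}"]) (use 1 in auto)
    then show ?thesis using 1 assms by (auto simp: power_0_left simp del: power_Suc)
  next
    case 2
    have "continuous_on UNIV (\<lambda>z. max 0 (z - c) ^ m)" by (intro continuous_intros)
    then have cont: "isCont (\<lambda>z. max 0 (z - c) ^ m) c" by (simp add: continuous_on_eq_continuous_at)
    \<comment> \<open>At the kink the difference quotient is itself a truncated power and
      continuous, so Caratheodory's criterion applies.\<close>
    have "\<exists>g. (\<forall>z. max 0 (z - c) ^ Suc m - max 0 (c - c) ^ Suc m = g z * (z - c)) \<and>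
        isCont g c \<and> g c = 0"
      by (rule exI[where x = "\<lambda>z. max 0 (z - c) ^ m"])
        (use assms cont in \<open>auto simp: max_def\<close>)
    then have "((\<lambda>x. max 0 (x - c) ^ Suc m) has_real_derivative 0) (at c)"
      unfolding CARAT_DERIV .
    then show ?thesis using 2 assms by (simp add: power_0_left del: power_Suc)
  next
    case 3
    have "((\<lambda>x. (x - c) ^ Suc m) has_real_derivative real (Suc m) * (x - c) ^ m) (at x)"
      by (auto intro!: derivative_eq_intros simp del: power_Suc)
    then have "((\<lambda>x. max 0 (x - c) ^ Suc m) has_real_derivative real (Suc m) * (x - c) ^ m) (at x)"
      by (rule has_field_derivative_transform_within_open[where S = "{c<..}"]) (use 3 in auto)
    then show ?thesis using 3 by simp
  qed
qed

lemma reflected_truncated_power_derivative: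
  fixes c x :: real
  assumes "m \<ge> 1"
  shows "((\<lambda>x. max 0 (c - x) ^ Suc m) has_real_derivative - (real (Suc m) * max 0 (c - x) ^ m)) (at x)"
proof -
  have "((\<lambda>y. max 0 (- y - (- c)) ^ Suc m) has_real_derivative
      - (real (Suc m) * max 0 (- x - (- c)) ^ m)) (at x)"
    by (rule DERIV_cong[OF DERIV_chain2[where g = uminus,
          OF truncated_power_derivative[OF assms, of "- c" "- x"]]])
      (auto intro!: derivative_eq_intros)
  then show ?thesis by (simp add: add.commute[of "- _" c] del: power_Suc)
qed

lemma monospline_derivative:
  assumes "m \<ge> 1"
  shows "(monospline (Suc m) I a \<tau> has_real_derivative monospline m I a \<tau> t) (at t)"
proof -
  have "((\<lambda>t. t ^ Suc (Suc m) / fact (Suc (Suc m))) has_real_derivative t ^ Suc m / fact (Suc m)) (at t)"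
  proof -
    have "((\<lambda>t. t ^ Suc (Suc m) / fact (Suc (Suc m))) has_real_derivative
        (real (Suc (Suc m)) * t ^ Suc m) / fact (Suc (Suc m))) (at t)"
      by (rule DERIV_cdivide) (auto intro!: derivative_eq_intros simp del: power_Suc)
    moreover have "(real (Suc (Suc m)) * t ^ Suc m) / fact (Suc (Suc m)) = t ^ Suc m / fact (Suc m)"
      by (simp only: fact_Suc[of "Suc m"] of_nat_mult) (simp del: power_Suc fact_Suc)
    ultimately show ?thesis by simp
  qed
  moreover have "((\<lambda>t. (\<Sum>i\<in>I. a i * max 0 (t - \<tau> i) ^ Suc m) / fact (Suc m)) has_real_derivative
      (\<Sum>i\<in>I. a i * (real (Suc m) * max 0 (t - \<tau> i) ^ m)) / fact (Suc m)) (at t)"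
    by (intro DERIV_cdivide DERIV_sum DERIV_cmult truncated_power_derivative assms)
  moreover have "(\<Sum>i\<in>I. a i * (real (Suc m) * max 0 (t - \<tau> i) ^ m)) / fact (Suc m) =
      (\<Sum>i\<in>I. a i * max 0 (t - \<tau> i) ^ m) / fact m"
  proof -
    have "(\<Sum>i\<in>I. a i * (real (Suc m) * max 0 (t - \<tau> i) ^ m)) =
        real (Suc m) * (\<Sum>i\<in>I. a i * max 0 (t - \<tau> i) ^ m)"
      by (simp add: sum_distrib_left mult.left_commute)
    then show ?thesis by (simp only: fact_Suc) (simp del: of_nat_Suc)
  qed
  ultimately show ?thesis
    unfolding monospline_def[abs_def] by (auto intro!: DERIV_diff simp del: power_Suc fact_Suc)
qed

section \<open>Taylor's formula with integral remainder and the Peano representation\<close>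

lemma C01_has_vector_derivative:
  assumes "f \<in> C01 r" "m < r" "t \<in> {0..1}"
  shows "(deriv01 m f has_vector_derivative deriv01 (Suc m) f t) (at t within {0..1})"
  using assms by (auto simp: C01_def differentiable_on_def vector_derivative_works)

lemma C01_continuous_on:
  assumes "f \<in> C01 r"
  shows "continuous_on {0..1} f"
proof (cases r)
  case 0
  with assms show ?thesis by (simp add: C01_def)
next
  case (Suc r')
  with assms have "deriv01 0 f differentiable_on {0..1}" unfolding C01_def by blast
  then show ?thesis by (simp add: differentiable_imp_continuous_on)
qed

text \<open>Truncation extends the remainder integral from \<open>{0..\<tau>}\<close> to
  \<open>{0..1}\<close>, so that the expansions at different nodes can be summed under one
  integral.\<close>

lemma taylor_at_node:
  assumes f: "f \<in> C01 (Suc m)" and m: "m \<ge> 1" and \<tau>: "0 \<le> \<tau>" "\<tau> \<le> 1"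
  shows "((\<lambda>t. max 0 (\<tau> - t) ^ m / fact m * deriv01 (Suc m) f t) has_integral
     (f \<tau> - (\<Sum>j\<le>m. \<tau> ^ j / fact j * deriv01 j f 0))) {0..1}"
proof -
  have "((\<lambda>x. ((\<tau> - x) ^ (Suc m - 1) / fact (Suc m - 1)) *\<^sub>R deriv01 (Suc m) f x) has_integral
      f \<tau> - (\<Sum>j<Suc m. ((\<tau> - 0) ^ j / fact j) *\<^sub>R deriv01 j f 0)) {0..\<tau>}"
  proof (rule Taylor_has_integral)
    fix k t assume "k < Suc m" "0 \<le> t" "t \<le> \<tau>"
    then have "(deriv01 k f has_vector_derivative deriv01 (Suc k) f t) (at t within {0..1})"
      using C01_has_vector_derivative[OF f, of k t] \<tau> by auto
    then show "(deriv01 k f has_vector_derivative deriv01 (Suc k) f t) (at t within {0..\<tau>})"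
      by (rule has_vector_derivative_within_subset) (use \<tau> in auto)
  qed (use \<tau> in auto)
  then have "((\<lambda>t. if t \<in> {0..\<tau>} then (\<tau> - t) ^ m / fact m * deriv01 (Suc m) f t else 0) has_integral
     (f \<tau> - (\<Sum>j\<le>m. \<tau> ^ j / fact j * deriv01 j f 0))) {0..1}"
    using \<tau> by (subst has_integral_restrict) (auto simp: lessThan_Suc_atMost)
  \<comment> \<open>Past the node the truncated power must vanish; since \<open>0 ^ 0 = 1\<close>,
    this uses \<open>m \<ge> 1\<close>.\<close>
  then show ?thesis
    by (rule has_integral_eq[rotated]) (use m in \<open>auto simp: max_def\<close>)
qed

text \<open>Taylor's formula, one order higher, for the antiderivative of \<open>f\<close> vanishing
  at 0; the shift turns \<open>fact j\<close> into \<open>fact (Suc j)\<close>.\<close>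

lemma taylor_of_integral:
  assumes f: "f \<in> C01 (Suc m)"
  shows "((\<lambda>t. (1 - t) ^ Suc m / fact (Suc m) * deriv01 (Suc m) f t) has_integral
     (integral {0..1} f - (\<Sum>j\<le>m. deriv01 j f 0 / fact (Suc j)))) {0..1}"
proof -
  define F where "F = (\<lambda>x. integral {0..x} f)"
  define D where "D = (\<lambda>k. case k of 0 \<Rightarrow> F | Suc j \<Rightarrow> deriv01 j f)"
  have "((\<lambda>x. ((1 - x) ^ (Suc (Suc m) - 1) / fact (Suc (Suc m) - 1)) *\<^sub>R D (Suc (Suc m)) x) has_integral
      F 1 - (\<Sum>j<Suc (Suc m). ((1 - 0) ^ j / fact j) *\<^sub>R D j 0)) {0..1}"
  proof (rule Taylor_has_integral)
    show "D 0 = F" by (simp add: D_def)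
    fix k t :: real assume "0 \<le> t" "t \<le> 1"
    fix k assume "k < Suc (Suc m)"
    show "(D k has_vector_derivative D (Suc k) t) (at t within {0..1})"
    proof (cases k)
      case 0
      then show ?thesis unfolding D_def F_def
        using integral_has_vector_derivative[OF C01_continuous_on[OF f], of t] \<open>0 \<le> t\<close> \<open>t \<le> 1\<close>
        by simp
    next
      case (Suc j)
      then show ?thesis unfolding D_def
        using C01_has_vector_derivative[OF f, of j t] \<open>k < Suc (Suc m)\<close> \<open>0 \<le> t\<close> \<open>t \<le> 1\<close> by simp
    qed
  qed auto
  moreover have "(\<Sum>j<Suc (Suc m). ((1 - 0) ^ j / fact j) *\<^sub>R D j 0) =
      (\<Sum>j\<le>m. deriv01 j f 0 / fact (Suc j))"
    by (subst sum.lessThan_Suc_shift)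
      (simp add: D_def F_def lessThan_Suc_atMost del: fact_Suc sum.lessThan_Suc)
  ultimately show ?thesis
    by (simp add: D_def F_def del: fact_Suc sum.lessThan_Suc power_Suc deriv01.simps)
qed

text \<open>When the weighted node expansions are subtracted from that of the integral, the moments
  cancel the Taylor polynomials at 0. The truncated powers face left, and
  \<open>\<tau> i - t = (1 - t) - (1 - \<tau> i)\<close>, hence a monospline in \<open>1 - t\<close>
  with reflected nodes.\<close>

lemma peano_kernel:
  assumes f: "f \<in> C01 (Suc m)" and m: "m \<ge> 1" and I: "finite I"
    and \<tau>: "\<And>i. i \<in> I \<Longrightarrow> 0 \<le> \<tau> i \<and> \<tau> i \<le> 1"
    and moments: "\<And>j. j \<le> m \<Longrightarrow> (\<Sum>i\<in>I. a i * \<tau> i ^ j) = 1 / real (Suc j)"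
  shows "((\<lambda>t. monospline m I a (\<lambda>i. 1 - \<tau> i) (1 - t) * deriv01 (Suc m) f t) has_integral
     (integral {0..1} f - (\<Sum>i\<in>I. a i * f (\<tau> i)))) {0..1}"
proof -
  let ?d = "\<lambda>j. deriv01 j f 0"
  have "((\<lambda>t. (1 - t) ^ Suc m / fact (Suc m) * deriv01 (Suc m) f t -
        (\<Sum>i\<in>I. a i * (max 0 (\<tau> i - t) ^ m / fact m * deriv01 (Suc m) f t))) has_integral
     (integral {0..1} f - (\<Sum>j\<le>m. ?d j / fact (Suc j)) -
       (\<Sum>i\<in>I. a i * (f (\<tau> i) - (\<Sum>j\<le>m. \<tau> i ^ j / fact j * ?d j))))) {0..1}"
    by (intro has_integral_diff has_integral_sum has_integral_mult_right taylor_of_integral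
        taylor_at_node f m I) (use \<tau> in auto)
  moreover have "(\<Sum>i\<in>I. a i * (\<Sum>j\<le>m. \<tau> i ^ j / fact j * ?d j)) = (\<Sum>j\<le>m. ?d j / fact (Suc j))"
  proof -
    have "(\<Sum>i\<in>I. a i * (\<Sum>j\<le>m. \<tau> i ^ j / fact j * ?d j)) =
        (\<Sum>j\<le>m. (\<Sum>i\<in>I. a i * \<tau> i ^ j) * (?d j / fact j))"
      by (simp add: sum_distrib_left sum_distrib_right sum.swap[of _ I] mult_ac)
    also have "\<dots> = (\<Sum>j\<le>m. ?d j / fact (Suc j))"
      by (rule sum.cong) (auto simp: moments)
    finally show ?thesis .
  qed
  ultimately have "((\<lambda>t. (1 - t) ^ Suc m / fact (Suc m) * deriv01 (Suc m) f t -
        (\<Sum>i\<in>I. a i * (max 0 (\<tau> i - t) ^ m / fact m * deriv01 (Suc m) f t))) has_integral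
     (integral {0..1} f - (\<Sum>i\<in>I. a i * f (\<tau> i)))) {0..1}"
    by (simp add: right_diff_distrib sum_subtractf)
  moreover have "monospline m I a (\<lambda>i. 1 - \<tau> i) (1 - t) * deriv01 (Suc m) f t =
      (1 - t) ^ Suc m / fact (Suc m) * deriv01 (Suc m) f t -
        (\<Sum>i\<in>I. a i * (max 0 (\<tau> i - t) ^ m / fact m * deriv01 (Suc m) f t))" for t
    by (simp add: monospline_def left_diff_distrib sum_divide_distrib sum_distrib_right mult.assoc
        del: power_Suc fact_Suc)
  ultimately show ?thesis by simp
qed

lemma weighted_integral_bounds:
  fixes K :: "real \<Rightarrow> real"
  assumes f: "f \<in> C01 (Suc m)" and pos: "\<And>x. x \<in> {0..1} \<Longrightarrow> 0 \<le> deriv01 (Suc m) f x"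
    and K: "\<And>t. t \<in> {0..1} \<Longrightarrow> L \<le> K t \<and> K t \<le> U"
    and R: "((\<lambda>t. K t * deriv01 (Suc m) f t) has_integral R) {0..1}"
  shows "L * (deriv01 m f 1 - deriv01 m f 0) \<le> R" "R \<le> U * (deriv01 m f 1 - deriv01 m f 0)"
proof -
  have *: "((\<lambda>t. c * deriv01 (Suc m) f t) has_integral c * (deriv01 m f 1 - deriv01 m f 0)) {0..1}" for c
    by (intro has_integral_mult_right fundamental_theorem_of_calculus)
      (auto intro: C01_has_vector_derivative[OF f] simp del: deriv01.simps)
  show "L * (deriv01 m f 1 - deriv01 m f 0) \<le> R"
    by (rule has_integral_le[OF * R]) (use K pos in \<open>auto intro: mult_right_mono simp del: deriv01.simps\<close>)
  show "R \<le> U * (deriv01 m f 1 - deriv01 m f 0)"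
    by (rule has_integral_le[OF R *]) (use K pos in \<open>auto intro: mult_right_mono simp del: deriv01.simps\<close>)
qed

section \<open>Exactness on splines\<close>

text \<open>Membership refers to derivatives within \<open>{0..1}\<close>; a two-sided derivative
  \<open>g\<close> is easier to supply. For \<open>r = 3\<close> only continuity is at
  stake.\<close>

lemma spline_spaceI:
  assumes "n \<ge> 1" "r = 3 \<or> r = 4"
    and piece: "\<And>k. k < n \<Longrightarrow> \<exists>p::real poly. degree p \<le> r - 1 \<and>
       (\<forall>x\<in>{real k / real n <..< real (k + 1) / real n}. f x = poly p x)"
    and cont: "continuous_on {0..1} f"
    and deriv: "r = 4 \<Longrightarrow> (\<forall>x. (f has_real_derivative g x) (at x)) \<and> continuous_on {0..1} g"
  shows "f \<in> spline_space n r"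
proof -
  have "f \<in> C01 (r - 3)"
  proof (cases "r = 4")
    case False
    then show ?thesis using assms by (auto simp: C01_def)
  next
    case True
    have d: "(f has_vector_derivative g x) (at x within {0..1})" for x
      using deriv[OF True] by (auto simp: has_real_derivative_iff_has_vector_derivative
          intro: has_vector_derivative_at_within)
    have "vector_derivative f (at x within {0..1}) = g x" if "x \<in> {0..1}" for x
      using d that by (intro vector_derivative_within_closed_interval) auto
    then have "continuous_on {0..1} (\<lambda>x. vector_derivative f (at x within {0..1}))"
      using deriv[OF True] continuous_on_eq[of "{0..1}" g] by simp
    moreover have "f differentiable_on {0..1}"
      using d by (auto simp: differentiable_on_def intro: differentiableI_vector)
    ultimately show ?thesis using True by (simp add: C01_def)
  qed
  then show ?thesis using piece by (auto simp: spline_space_def)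
qed

lemma poly_in_spline_space:
  assumes "n \<ge> 1" "r = 3 \<or> r = 4" "degree p \<le> r - 1"
  shows "poly p \<in> spline_space n r"
  by (rule spline_spaceI[where g = "poly (pderiv p)"])
    (use assms in \<open>auto intro!: continuous_intros poly_DERIV\<close>)

text \<open>Both powers are smooth enough at the knot. Testing exactness on the two of them is what
  gives the kernel a double zero there.\<close>

lemma truncated_power_in_spline_space:
  assumes n: "n \<ge> 1" and r: "r = 3 \<or> r = 4" and k: "k \<le> n" and m: "m = r - 1 \<or> m = r - 2"
  shows "(\<lambda>x. max 0 (real k / real n - x) ^ m) \<in> spline_space n r"
proof -
  define c where "c = real k / real n"
  have piece: "\<exists>p::real poly. degree p \<le> r - 1 \<and>
       (\<forall>x\<in>{real j / real n <..< real (j + 1) / real n}. max 0 (c - x) ^ m = poly p x)" for j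
  proof (cases "j < k")
    case True
    have "degree ([:c, -1:] ^ m) \<le> degree [:c, -1:] * m" by (rule degree_power_le)
    then have "degree ([:c, -1:] ^ m) \<le> r - 1" using m by auto
    moreover have "max 0 (c - x) ^ m = poly ([:c, -1:] ^ m) x"
      if "x \<in> {real j / real n <..< real (j + 1) / real n}" for x
    proof -
      have "real (j + 1) / real n \<le> c" unfolding c_def
        by (rule divide_right_mono) (use True in linarith, simp)
      then show ?thesis using that by (auto simp: max_def)
    qed
    ultimately show ?thesis by (intro exI[where x = "[:c, -1:] ^ m"] conjI ballI)
  next
    case False
    have "max 0 (c - x) ^ m = poly 0 x" if "x \<in> {real j / real n <..< real (j + 1) / real n}" for x
    proof -
      have "c \<le> real j / real n" unfolding c_def using False by (intro divide_right_mono) auto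
      then show ?thesis using that m r by (auto simp: max_def)
    qed
    then show ?thesis by (intro exI[where x = 0] conjI ballI) auto
  qed
  show ?thesis unfolding c_def[symmetric]
  proof (rule spline_spaceI[where g = "\<lambda>x. - (real m * max 0 (c - x) ^ (m - 1))"])
    assume "r = 4"
    then have "m = Suc (m - 1)" "m - 1 \<ge> 1" using m by auto
    then show "(\<forall>x. ((\<lambda>x. max 0 (c - x) ^ m) has_real_derivative - (real m * max 0 (c - x) ^ (m - 1))) (at x)) \<and>
       continuous_on {0..1} (\<lambda>x. - (real m * max 0 (c - x) ^ (m - 1)))"
      using reflected_truncated_power_derivative[of "m - 1" c]
      by (auto intro!: continuous_intros)
  qed (use n r piece in \<open>auto intro!: continuous_intros\<close>)
qed

section \<open>Moments of the rule and double zeros of the kernel at the knots\<close>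

lemma integral_truncated_power:
  fixes c :: real
  assumes "m \<ge> 1" "0 \<le> c" "c \<le> 1"
  shows "integral {0..1} (\<lambda>x. max 0 (c - x) ^ m) = c ^ Suc m / real (Suc m)"
proof -
  have "((\<lambda>x. max 0 (c - x) ^ m) has_integral
      - (max 0 (c - 1) ^ Suc m / real (Suc m)) - (- (max 0 (c - 0) ^ Suc m / real (Suc m)))) {0..1}"
  proof (rule fundamental_theorem_of_calculus)
    fix x
    have "((\<lambda>x. - (max 0 (c - x) ^ Suc m / real (Suc m))) has_real_derivative
        - (- (real (Suc m) * max 0 (c - x) ^ m) / real (Suc m))) (at x within {0..1})"
      by (intro DERIV_minus DERIV_cdivide has_field_derivative_at_within[OF
            reflected_truncated_power_derivative] assms)
    then show "((\<lambda>x. - (max 0 (c - x) ^ Suc m / real (Suc m))) has_vector_derivative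
        max 0 (c - x) ^ m) (at x within {0..1})"
      by (simp add: has_real_derivative_iff_has_vector_derivative del: power_Suc of_nat_Suc)
  qed simp
  then show ?thesis using assms by (simp add: integral_unique)
qed

lemma integral_shifted_power:
  fixes t :: real
  shows "integral {0..1} (\<lambda>x. (x - t) ^ j) = ((1 - t) ^ Suc j - (- t) ^ Suc j) / real (Suc j)"
proof -
  have "((\<lambda>x. (x - t) ^ j) has_integral
      (1 - t) ^ Suc j / real (Suc j) - (0 - t) ^ Suc j / real (Suc j)) {0..1}"
  proof (rule fundamental_theorem_of_calculus)
    fix x
    have "((\<lambda>x. (x - t) ^ Suc j / real (Suc j)) has_real_derivative
        (real (Suc j) * (x - t) ^ j) / real (Suc j)) (at x within {0..1})"
      by (rule DERIV_cdivide) (auto intro!: derivative_eq_intros simp del: power_Suc of_nat_Suc)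
    then show "((\<lambda>x. (x - t) ^ Suc j / real (Suc j)) has_vector_derivative (x - t) ^ j) (at x within {0..1})"
      by (simp add: has_real_derivative_iff_has_vector_derivative del: power_Suc of_nat_Suc)
  qed simp
  then show ?thesis by (simp add: integral_unique diff_divide_distrib del: power_Suc of_nat_Suc)
qed

locale spline_exact_rule =
  fixes n m :: nat and I :: "'i set" and a \<tau> :: "'i \<Rightarrow> real"
  assumes n: "n \<ge> 1" and m: "m = 2 \<or> m = 3" and finite_I: "finite I"
    and nodes: "\<And>i. i \<in> I \<Longrightarrow> 0 \<le> \<tau> i \<and> \<tau> i \<le> 1"
    and exact: "\<And>f. f \<in> spline_space n (Suc m) \<Longrightarrow> (\<Sum>i\<in>I. a i * f (\<tau> i)) = integral {0..1} f"
begin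

abbreviation "M \<equiv> \<lambda>j. monospline j I a \<tau>"

text \<open>The shift \<open>t\<close> stays free: 0 yields the moments, 1 those of the reflected
  rule, and a general \<open>t\<close> the reflection of the kernel.\<close>

lemma exact_power:
  assumes "j \<le> m"
  shows "(\<Sum>i\<in>I. a i * (\<tau> i - t) ^ j) = ((1 - t) ^ Suc j - (- t) ^ Suc j) / real (Suc j)"
proof -
  have "degree ([:- t, 1:] ^ j) \<le> degree [:- t, 1:] * j" by (rule degree_power_le)
  then have "poly ([:- t, 1:] ^ j) \<in> spline_space n (Suc m)"
    using assms n m by (intro poly_in_spline_space) auto
  moreover have "poly ([:- t, 1:] ^ j) = (\<lambda>x. (x - t) ^ j)"
    by (simp add: fun_eq_iff)
  ultimately show ?thesis
    using exact[of "\<lambda>x. (x - t) ^ j"] integral_shifted_power[of t j] by simp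
qed

lemma moments: "j \<le> m \<Longrightarrow> (\<Sum>i\<in>I. a i * \<tau> i ^ j) = 1 / real (Suc j)"
  using exact_power[of j 0] by simp

lemma reflected_moments:
  assumes "j \<le> m" shows "(\<Sum>i\<in>I. a i * (1 - \<tau> i) ^ j) = 1 / real (Suc j)"
proof -
  have "(\<Sum>i\<in>I. a i * (1 - \<tau> i) ^ j) = (\<Sum>i\<in>I. (-1) ^ j * (a i * (\<tau> i - 1) ^ j))"
  proof (rule sum.cong)
    fix i
    have "(1 - \<tau> i) ^ j = ((-1) * (\<tau> i - 1)) ^ j" by simp
    then show "a i * (1 - \<tau> i) ^ j = (-1) ^ j * (a i * (\<tau> i - 1) ^ j)"
      by (simp only: power_mult_distrib) simp
  qed simp
  also have "\<dots> = (-1) ^ j * (- ((-1) ^ Suc j) / real (Suc j))"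
    using exact_power[OF assms, of 1] by (simp add: sum_distrib_left[symmetric])
  also have "\<dots> = 1 / real (Suc j)" by (simp add: power_add[symmetric] mult_2[symmetric])
  finally show ?thesis .
qed

text \<open>A full power is, up to sign, the sum of its two truncations, and exactness evaluates the
  weighted sum of full powers. So the left-facing kernel of \<open>peano_kernel\<close> is the
  right-facing \<open>M m\<close> up to sign.\<close>

lemma monospline_reflect:
  "monospline m I a (\<lambda>i. 1 - \<tau> i) (1 - t) = (-1) ^ Suc m * M m t"
proof -
  have m1: "m \<ge> 1" using m by auto
  have "max 0 (\<tau> i - t) ^ m = (\<tau> i - t) ^ m - (-1) ^ m * max 0 (t - \<tau> i) ^ m" for i
  proof (cases "\<tau> i < t")
    case True
    have "(\<tau> i - t) ^ m = ((-1) * (t - \<tau> i)) ^ m" by simp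
    also have "\<dots> = (-1) ^ m * (t - \<tau> i) ^ m" by (rule power_mult_distrib)
    finally show ?thesis using True m1 by (simp add: max_def)
  qed (use m1 in \<open>simp add: max_def\<close>)
  then have "(\<Sum>i\<in>I. a i * max 0 (\<tau> i - t) ^ m) =
      (\<Sum>i\<in>I. a i * (\<tau> i - t) ^ m) - (-1) ^ m * (\<Sum>i\<in>I. a i * max 0 (t - \<tau> i) ^ m)"
    by (simp add: right_diff_distrib sum_subtractf sum_distrib_left mult_ac)
  also have "\<dots> = ((1 - t) ^ Suc m - (- t) ^ Suc m) / real (Suc m)
      - (-1) ^ m * (\<Sum>i\<in>I. a i * max 0 (t - \<tau> i) ^ m)"
    using exact_power[of m t] by simp
  finally show ?thesis
    using m by (auto simp: monospline_def fact_numeral field_simps eval_nat_numeral)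
qed

text \<open>At a knot \<open>c\<close>, \<open>fact j * M j c\<close> is the remainder of the rule
  on the spline \<open>max 0 (c - x) ^ j\<close>.\<close>

lemma monospline_at_knot:
  assumes "k \<le> n" "j = m \<or> Suc j = m"
  shows "M j (real k / real n) = 0"
proof -
  define c where "c = real k / real n"
  have c: "0 \<le> c" "c \<le> 1" using assms n by (auto simp: c_def)
  have j: "j \<ge> 1" using assms m by auto
  have "(\<lambda>x. max 0 (c - x) ^ j) \<in> spline_space n (Suc m)"
    unfolding c_def using assms n m by (intro truncated_power_in_spline_space) auto
  from exact[OF this] have "(\<Sum>i\<in>I. a i * max 0 (c - \<tau> i) ^ j) = c ^ Suc j / real (Suc j)"
    using integral_truncated_power[OF j c] by simp
  then show ?thesis unfolding c_def[symmetric] by (simp add: monospline_def del: power_Suc)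
qed

lemma remainder_integral:
  assumes "f \<in> C01 (Suc m)"
  shows "((\<lambda>t. (-1) ^ Suc m * M m t * deriv01 (Suc m) f t) has_integral
     (integral {0..1} f - (\<Sum>i\<in>I. a i * f (\<tau> i)))) {0..1}"
  using peano_kernel[OF assms _ finite_I, of \<tau> a] m nodes moments
  by (auto simp: monospline_reflect)

text \<open>Reflecting the nodes twice restores \<open>\<tau>\<close>, so \<open>M m\<close> appears
  without the sign \<open>(-1) ^ Suc m\<close>. For \<open>m = 2\<close> this is why the left and
  right Radau remainders have opposite signs.\<close>

lemma reflected_remainder_integral:
  assumes "f \<in> C01 (Suc m)"
  shows "((\<lambda>t. M m (1 - t) * deriv01 (Suc m) f t) has_integral
     (integral {0..1} f - (\<Sum>i\<in>I. a i * f (1 - \<tau> i)))) {0..1}"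
  using peano_kernel[OF assms _ finite_I, of "\<lambda>i. 1 - \<tau> i" a] m nodes reflected_moments
  by auto

end

section \<open>The Radau rule\<close>

text \<open>One cell scaled to unit length, with \<open>c\<close> the second derivative of the
  kernel at its left end. \<open>val\<close> and \<open>der\<close> express the double zero at
  \<open>s = 1\<close>; \<open>c + 1 - a\<close> is the second derivative there, handed on to the
  next cell.\<close>

lemma radau_local_step:
  fixes c a \<theta> :: real
  assumes c: "0 \<le> c" "c \<le> sqrt 3 / 6" and \<theta>: "0 < \<theta>" "\<theta> < 1"
    and val: "c / 2 + 1 / 6 - a * (1 - \<theta>)\<^sup>2 / 2 = 0" and der: "c + 1 / 2 - a * (1 - \<theta>) = 0"
  shows "0 \<le> c + 1 - a" "c + 1 - a \<le> sqrt 3 / 6"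
    and "0 \<le> s \<Longrightarrow> s \<le> 1 \<Longrightarrow> 0 \<le> c * s\<^sup>2 / 2 + s ^ 3 / 6 - a * (max 0 (s - \<theta>))\<^sup>2 / 2"
    and "0 \<le> s \<Longrightarrow> s \<le> 1 \<Longrightarrow>
      c * s\<^sup>2 / 2 + s ^ 3 / 6 - a * (max 0 (s - \<theta>))\<^sup>2 / 2 \<le> sqrt 3 / 108"
proof -
  define u where "u = 1 - \<theta>"
  define d where "d = c + 1 - a"
  have u: "0 < u" "u < 1" using \<theta> by (auto simp: u_def)
  have au: "a * u = c + 1 / 2" using der by (simp add: u_def)
  have "a * u * u = c + 1 / 3" using val by (simp add: u_def power2_eq_square)
  then have u_eq: "(c + 1 / 2) * u = c + 1 / 3" by (simp add: au)
  have "a * ((c + 1 / 2) * u) = (c + 1 / 2) * (a * u)" by simp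
  then have a_eq: "a * (c + 1 / 3) = (c + 1 / 2)\<^sup>2"
    by (simp only: u_eq au) (simp add: power2_eq_square)
  have d_eq: "d * (12 * c + 4) = 4 * c + 1"
    using a_eq unfolding d_def by (simp add: algebra_simps power2_eq_square)
  have d0: "0 \<le> d"
  proof (rule ccontr)
    assume "\<not> 0 \<le> d"
    then have "d * (12 * c + 4) < 0" using c by (intro mult_neg_pos) auto
    then show False using d_eq c by simp
  qed
  show "0 \<le> c + 1 - a" using d0 by (simp add: d_def)
  have s3: "sqrt 3 * sqrt 3 = (3::real)" by simp
  have d1: "d \<le> sqrt 3 / 6"
  proof -
    have "sqrt 3 * 2 \<le> (4::real)" using real_sqrt_le_mono[of 3 4] by simp
    \<comment> \<open>Cleared of its denominator, the claim is linear in \<open>c\<close> with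
      nonnegative slope \<open>4 - 2 * sqrt 3\<close>, and it is an equality at the fixed
      point.\<close>
    have "(4 - 2 * sqrt 3) * c \<le> (4 - 2 * sqrt 3) * (sqrt 3 / 6)"
      by (rule mult_left_mono) (use c \<open>sqrt 3 * 2 \<le> 4\<close> in auto)
    also have "\<dots> = 4 * (sqrt 3 / 6) - 1" using s3 by (simp add: algebra_simps)
    finally have "4 * c + 1 \<le> sqrt 3 / 6 * (12 * c + 4)" by (simp add: algebra_simps)
    then have "d * (12 * c + 4) \<le> sqrt 3 / 6 * (12 * c + 4)" using d_eq by simp
    then show ?thesis by (rule mult_right_le_imp_le) (use c in auto)
  qed
  then show "c + 1 - a \<le> sqrt 3 / 6" by (simp add: d_def)
  \<comment> \<open>Beyond the node this is the Taylor expansion about \<open>s = 1\<close>: a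
    double zero, second derivative \<open>d\<close>, leading coefficient 1/6.\<close>
  have right: "c * s\<^sup>2 / 2 + s ^ 3 / 6 - a * (s - \<theta>)\<^sup>2 / 2 = (1 - s)\<^sup>2 * (d / 2 - (1 - s) / 6)" for s
  proof -
    have "a * \<theta> = a - c - 1 / 2" using au by (simp add: u_def algebra_simps)
    moreover have "a * \<theta> * \<theta> = a - c - 2 / 3"
      using \<open>a * u * u = c + 1 / 3\<close> calculation by (simp add: u_def algebra_simps)
    moreover have "a * (s - \<theta>)\<^sup>2 = a * s\<^sup>2 - 2 * s * (a * \<theta>) + a * \<theta> * \<theta>"
      by (simp add: power2_eq_square algebra_simps)
    ultimately have "a * (s - \<theta>)\<^sup>2 = a * s\<^sup>2 - 2 * s * (a - c - 1 / 2) + (a - c - 2 / 3)"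
      by (simp only:)
    then show ?thesis unfolding d_def by (simp add: power2_eq_square power3_eq_cube field_simps)
  qed
  have bound: "w\<^sup>2 * (d / 2 - w / 6) \<le> sqrt 3 / 108" if "0 \<le> w" for w
  proof -
    \<comment> \<open>For \<open>w \<ge> 0\<close> the cubic is largest at \<open>w = 2 * d\<close>,
      with value \<open>2 / 3 * d ^ 3\<close>; the gap to that value has a double root
      there.\<close>
    have "0 \<le> (w - 2 * d)\<^sup>2 * (w + d)" using that d0 by simp
    also have "\<dots> = 4 * d ^ 3 - 6 * (w\<^sup>2 * (d / 2 - w / 6))"
      by (simp add: power2_eq_square power3_eq_cube field_simps)
    finally have "w\<^sup>2 * (d / 2 - w / 6) \<le> 2 / 3 * d ^ 3" by linarith
    also have "\<dots> \<le> 2 / 3 * (sqrt 3 / 6) ^ 3" using power_mono[OF d1 d0, of 3] by simp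
    also have "\<dots> = sqrt 3 / 108" using s3 by (simp add: power3_eq_cube)
    finally show ?thesis .
  qed
  \<comment> \<open>Before the node the kernel increases, so its value at the node, where both
    formulas agree, dominates.\<close>
  have left_mono: "c * s\<^sup>2 / 2 + s ^ 3 / 6 \<le> u\<^sup>2 * (d / 2 - u / 6)" if "0 \<le> s" "s \<le> \<theta>" for s
  proof -
    have "c * s\<^sup>2 \<le> c * \<theta>\<^sup>2" "s ^ 3 \<le> \<theta> ^ 3"
      using that c by (auto intro!: mult_left_mono power_mono)
    then show ?thesis using right[of \<theta>] by (simp add: u_def)
  qed
  \<comment> \<open>The value at the node is nonnegative, so the linear factor is nonnegative at
    \<open>w = u\<close> and hence for all smaller \<open>w\<close>.\<close>
  have "0 \<le> u\<^sup>2 * (d / 2 - u / 6)" using left_mono[of 0] \<theta> by simp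
  then have du: "0 \<le> d / 2 - u / 6" using u by (simp add: zero_le_mult_iff)
  assume s: "0 \<le> s" "s \<le> 1"
  show "0 \<le> c * s\<^sup>2 / 2 + s ^ 3 / 6 - a * (max 0 (s - \<theta>))\<^sup>2 / 2"
  proof (cases "s \<le> \<theta>")
    case True
    then show ?thesis using c s by (simp add: max_def)
  next
    case False
    have "0 \<le> (1 - s)\<^sup>2 * (d / 2 - (1 - s) / 6)"
      using du False by (intro mult_nonneg_nonneg) (auto simp: u_def)
    then show ?thesis using False right[of s] by (simp add: max_def)
  qed
  show "c * s\<^sup>2 / 2 + s ^ 3 / 6 - a * (max 0 (s - \<theta>))\<^sup>2 / 2 \<le> sqrt 3 / 108"
  proof (cases "s \<le> \<theta>")
    case True
    then show ?thesis using left_mono[of s] bound[of u] u s by (simp add: max_def)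
  next
    case False
    then show ?thesis using right[of s] bound[of "1 - s"] s by (simp add: max_def)
  qed
qed

text \<open>Only nodes below 1 are counted, because the prescribed node at 1 lies in no open
  cell.\<close>

locale radau_rule = spline_exact_rule n 2 I a \<tau> for n and I :: "'i set" and a \<tau> +
  assumes card_inner: "card {i\<in>I. \<tau> i < 1} \<le> n"
begin

text \<open>\<open>curv t\<close> is the second derivative of \<open>M 2\<close>, taken from the right at the nodes.\<close>

definition curv :: "real \<Rightarrow> real" where
  "curv t = t - (\<Sum>i\<in>{i\<in>I. \<tau> i \<le> t}. a i)"

text \<open>Open at both ends: a node at the left knot already enters \<open>curv\<close>, and one
  at the right knot has a zero truncated power throughout the cell.\<close>

definition cell :: "nat \<Rightarrow> 'i set" where
  "cell k = {i\<in>I. real k / real n < \<tau> i \<and> \<tau> i < real (Suc k) / real n}"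

lemma finite_cell: "finite (cell k)"
  using finite_I by (simp add: cell_def)

text \<open>To the right of \<open>A\<close> the nodes up to \<open>A\<close> contribute one
  polynomial, absorbed into the Taylor coefficients at \<open>A\<close>; only later nodes keep
  truncated powers.\<close>

lemma monospline_expand:
  assumes "A \<le> t"
  shows "M 2 t = M 2 A + M 1 A * (t - A) + curv A * (t - A)\<^sup>2 / 2 + (t - A) ^ 3 / 6
      - (\<Sum>i\<in>{i\<in>I. A < \<tau> i}. a i * (max 0 (t - \<tau> i))\<^sup>2) / 2"
    and "M 1 t = M 1 A + curv A * (t - A) + (t - A)\<^sup>2 / 2
      - (\<Sum>i\<in>{i\<in>I. A < \<tau> i}. a i * max 0 (t - \<tau> i))"
proof -
  have "(\<Sum>i\<in>I. a i * (max 0 (t - \<tau> i))\<^sup>2) =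
      (\<Sum>i\<in>I. a i * (max 0 (A - \<tau> i))\<^sup>2 + a i * max 0 (A - \<tau> i) * (2 * (t - A))
      + (if \<tau> i \<le> A then a i else 0) * (t - A)\<^sup>2
      + (if A < \<tau> i then a i * (max 0 (t - \<tau> i))\<^sup>2 else 0))"
    using assms by (intro sum.cong refl) (auto simp: max_def power2_eq_square algebra_simps)
  also have "\<dots> = (\<Sum>i\<in>I. a i * (max 0 (A - \<tau> i))\<^sup>2)
      + (\<Sum>i\<in>I. a i * max 0 (A - \<tau> i)) * (2 * (t - A))
      + (\<Sum>i\<in>{i\<in>I. \<tau> i \<le> A}. a i) * (t - A)\<^sup>2
      + (\<Sum>i\<in>{i\<in>I. A < \<tau> i}. a i * (max 0 (t - \<tau> i))\<^sup>2)"
    by (simp only: sum.inter_filter[OF finite_I] sum_distrib_right sum.distrib)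
  finally have 2: "(\<Sum>i\<in>I. a i * (max 0 (t - \<tau> i))\<^sup>2) = \<dots>" .
  have "(\<Sum>i\<in>I. a i * max 0 (t - \<tau> i)) = (\<Sum>i\<in>I. a i * max 0 (A - \<tau> i)
      + (if \<tau> i \<le> A then a i else 0) * (t - A)
      + (if A < \<tau> i then a i * max 0 (t - \<tau> i) else 0))"
    using assms by (intro sum.cong refl) (auto simp: max_def algebra_simps)
  also have "\<dots> = (\<Sum>i\<in>I. a i * max 0 (A - \<tau> i))
      + (\<Sum>i\<in>{i\<in>I. \<tau> i \<le> A}. a i) * (t - A)
      + (\<Sum>i\<in>{i\<in>I. A < \<tau> i}. a i * max 0 (t - \<tau> i))"
    by (simp only: sum.inter_filter[OF finite_I] sum_distrib_right sum.distrib)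
  finally have 1: "(\<Sum>i\<in>I. a i * max 0 (t - \<tau> i)) = \<dots>" .
  show "M 2 t = M 2 A + M 1 A * (t - A) + curv A * (t - A)\<^sup>2 / 2 + (t - A) ^ 3 / 6
      - (\<Sum>i\<in>{i\<in>I. A < \<tau> i}. a i * (max 0 (t - \<tau> i))\<^sup>2) / 2"
    unfolding monospline_def curv_def 2
    by (simp add: fact_numeral eval_nat_numeral field_simps)
  show "M 1 t = M 1 A + curv A * (t - A) + (t - A)\<^sup>2 / 2
      - (\<Sum>i\<in>{i\<in>I. A < \<tau> i}. a i * max 0 (t - \<tau> i))"
    unfolding monospline_def curv_def power_one_right 1
    by (simp add: eval_nat_numeral field_simps)
qed

lemma monospline_on_cell:
  assumes k: "k < n" and s: "0 \<le> s" "s \<le> 1"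
  defines "A \<equiv> real k / real n"
  shows "M 2 (A + s / n) = curv A * (s / n)\<^sup>2 / 2 + (s / n) ^ 3 / 6
      - (\<Sum>i\<in>cell k. a i * (max 0 (A + s / n - \<tau> i))\<^sup>2) / 2"
    and "M 1 (A + s / n) = curv A * (s / n) + (s / n)\<^sup>2 / 2
      - (\<Sum>i\<in>cell k. a i * max 0 (A + s / n - \<tau> i))"
proof -
  have le: "A \<le> A + s / n" using s by simp
  have "M 2 A = 0" "M 1 A = 0" using monospline_at_knot[of k] k by (auto simp: A_def)
  have "A + s / n \<le> real (Suc k) / real n"
    using s n by (simp add: A_def field_simps)
  then have out: "max 0 (A + s / n - \<tau> i) = 0" if "i \<in> {i\<in>I. A < \<tau> i} - cell k" for i
    using that by (auto simp: cell_def A_def max_def)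
  have sub: "cell k \<subseteq> {i\<in>I. A < \<tau> i}" by (auto simp: cell_def A_def)
  have "(\<Sum>i\<in>{i\<in>I. A < \<tau> i}. a i * (max 0 (A + s / n - \<tau> i))\<^sup>2) =
      (\<Sum>i\<in>cell k. a i * (max 0 (A + s / n - \<tau> i))\<^sup>2)"
    by (rule sum.mono_neutral_right) (use finite_I sub out in auto)
  then show "M 2 (A + s / n) = curv A * (s / n)\<^sup>2 / 2 + (s / n) ^ 3 / 6
      - (\<Sum>i\<in>cell k. a i * (max 0 (A + s / n - \<tau> i))\<^sup>2) / 2"
    using monospline_expand(1)[OF le] \<open>M 2 A = 0\<close> \<open>M 1 A = 0\<close> by simp
  have "(\<Sum>i\<in>{i\<in>I. A < \<tau> i}. a i * max 0 (A + s / n - \<tau> i)) =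
      (\<Sum>i\<in>cell k. a i * max 0 (A + s / n - \<tau> i))"
    by (rule sum.mono_neutral_right) (use finite_I sub out in auto)
  then show "M 1 (A + s / n) = curv A * (s / n) + (s / n)\<^sup>2 / 2
      - (\<Sum>i\<in>cell k. a i * max 0 (A + s / n - \<tau> i))"
    using monospline_expand(2)[OF le] \<open>M 1 A = 0\<close> by simp
qed

lemma knot_Suc: "real k / real n + 1 / real n = real (Suc k) / real n"
  by (simp add: add_divide_distrib)

text \<open>The double zero at the right end of the cell. With a single node these two equations
  determine its position and weight.\<close>

lemma cell_equations:
  assumes "k < n"
  defines "A \<equiv> real k / real n"
  shows "curv A / (2 * real n ^ 2) + 1 / (6 * real n ^ 3)
      = (\<Sum>i\<in>cell k. a i * (real (Suc k) / real n - \<tau> i)\<^sup>2) / 2"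
    and "curv A / n + 1 / (2 * real n ^ 2) = (\<Sum>i\<in>cell k. a i * (real (Suc k) / real n - \<tau> i))"
proof -
  have "M 2 (real (Suc k) / real n) = 0" "M 1 (real (Suc k) / real n) = 0"
    using monospline_at_knot[of "Suc k"] assms by auto
  moreover have "(\<Sum>i\<in>cell k. a i * (max 0 (real (Suc k) / real n - \<tau> i))\<^sup>2) =
      (\<Sum>i\<in>cell k. a i * (real (Suc k) / real n - \<tau> i)\<^sup>2)"
    "(\<Sum>i\<in>cell k. a i * max 0 (real (Suc k) / real n - \<tau> i)) =
      (\<Sum>i\<in>cell k. a i * (real (Suc k) / real n - \<tau> i))"
    by (auto simp: cell_def max_def intro!: sum.cong)
  ultimately show "curv A / (2 * real n ^ 2) + 1 / (6 * real n ^ 3)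
      = (\<Sum>i\<in>cell k. a i * (real (Suc k) / real n - \<tau> i)\<^sup>2) / 2"
    "curv A / n + 1 / (2 * real n ^ 2) = (\<Sum>i\<in>cell k. a i * (real (Suc k) / real n - \<tau> i))"
    using monospline_on_cell[OF assms(1), of 1] unfolding A_def knot_Suc
    by (simp_all add: power_divide)
qed

text \<open>A nonzero cubic cannot have double zeros at both ends of the cell.\<close>

lemma cell_nonempty:
  assumes "k < n"
  shows "cell k \<noteq> {}"
proof
  assume "cell k = {}"
  then have "curv (real k / n) / (2 * real n ^ 2) + 1 / (6 * real n ^ 3) = 0"
    "curv (real k / n) / n + 1 / (2 * real n ^ 2) = 0"
    using cell_equations[OF assms] by auto
  then show False using n by (simp add: field_simps eval_nat_numeral)
qed

text \<open>Pigeonhole: \<open>n\<close> disjoint nonempty cells share at most \<open>n\<close>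
  nodes below 1.\<close>

lemma cells_exhaust:
  shows "k < n \<Longrightarrow> card (cell k) = 1" and "i \<in> I \<Longrightarrow> \<tau> i < 1 \<Longrightarrow> \<exists>k<n. i \<in> cell k"
proof -
  have disj: "cell j \<inter> cell k = {}" if "j < k" for j k
  proof -
    have "real (Suc j) / real n \<le> real k / real n"
      by (rule divide_right_mono) (use that in linarith, simp)
    then show ?thesis by (auto simp: cell_def)
  qed
  then have disj': "cell j \<inter> cell k = {}" if "j \<noteq> k" for j k
    using that by (metis inf_commute nat_neq_iff)
  have card_Un: "card (\<Union>k<n. cell k) = (\<Sum>k<n. card (cell k))"
    by (rule card_UN_disjoint) (use finite_cell disj' in auto)
  have sub: "(\<Union>k<n. cell k) \<subseteq> {i\<in>I. \<tau> i < 1}"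
  proof
    fix i assume "i \<in> (\<Union>k<n. cell k)"
    then obtain k where k: "k < n" "i \<in> cell k" by auto
    have "\<tau> i < real (Suc k) / real n" using k unfolding cell_def by blast
    also have "\<dots> \<le> 1" using k by simp
    finally show "i \<in> {i\<in>I. \<tau> i < 1}" using k by (simp add: cell_def)
  qed
  have le: "(\<Sum>k<n. card (cell k)) \<le> n"
    using card_mono[OF _ sub] card_inner finite_I card_Un by simp
  have ge: "1 \<le> card (cell k)" if "k < n" for k
    using cell_nonempty[OF that] finite_cell[of k] by (simp add: Suc_le_eq card_gt_0_iff)
  have eq: "card (cell k) = 1" if "k < n" for k
  proof (rule ccontr)
    assume "card (cell k) \<noteq> 1"
    with ge[OF that] have "1 < card (cell k)" by simp
    then have "(\<Sum>k<n. 1) < (\<Sum>k<n. card (cell k))"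
      by (intro sum_strict_mono_ex1) (use ge that in auto)
    with le show False by simp
  qed
  then show "k < n \<Longrightarrow> card (cell k) = 1" .
  have "(\<Union>k<n. cell k) = {i\<in>I. \<tau> i < 1}"
    by (rule card_seteq) (use finite_I sub card_Un eq card_inner in auto)
  then show "i \<in> I \<Longrightarrow> \<tau> i < 1 \<Longrightarrow> \<exists>k<n. i \<in> cell k" by blast
qed

lemma curv_Suc:
  assumes "Suc k < n"
  shows "curv (real (Suc k) / n) = curv (real k / n) + 1 / n - (\<Sum>i\<in>cell k. a i)"
proof -
  have lt: "real k / n < real (Suc k) / n" "real (Suc k) / n < 1"
    using assms by (auto simp: divide_strict_right_mono)
  \<comment> \<open>A node on this knot would enter \<open>curv\<close> without belonging to
    \<open>cell k\<close>. Since the knot is below 1, such a node would lie in some open cell,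
    forcing \<open>j < Suc k < Suc j\<close>.\<close>
  have "\<tau> i \<noteq> real (Suc k) / n" if "i \<in> I" for i
  proof
    assume eq: "\<tau> i = real (Suc k) / n"
    with lt cells_exhaust(2)[OF that] obtain j where "j < n" "i \<in> cell j" by auto
    then have "real j / n < real (Suc k) / n" "real (Suc k) / n < real (Suc j) / n"
      by (auto simp: cell_def eq)
    then show False using n by (auto simp: divide_less_cancel)
  qed
  then have "{i\<in>I. \<tau> i \<le> real (Suc k) / n} = {i\<in>I. \<tau> i \<le> real k / n} \<union> cell k"
    using lt by (force simp: cell_def)
  moreover have "{i\<in>I. \<tau> i \<le> real k / n} \<inter> cell k = {}" by (auto simp: cell_def)
  ultimately have "(\<Sum>i\<in>{i\<in>I. \<tau> i \<le> real (Suc k) / n}. a i) =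
      (\<Sum>i\<in>{i\<in>I. \<tau> i \<le> real k / n}. a i) + (\<Sum>i\<in>cell k. a i)"
    using finite_I finite_cell by (simp add: sum.union_disjoint)
  then show ?thesis unfolding curv_def by (simp add: add_divide_distrib)
qed

lemma curv_0: "curv 0 = 0"
proof -
  have "{i\<in>I. \<tau> i \<le> 0} = {}"
  proof (rule ccontr)
    assume "{i\<in>I. \<tau> i \<le> 0} \<noteq> {}"
    then obtain i where "i \<in> I" "\<tau> i \<le> 0" by auto
    then obtain j where "j < n" "i \<in> cell j" using cells_exhaust(2)[of i] by auto
    then have "real j / real n < 0" using \<open>\<tau> i \<le> 0\<close> unfolding cell_def by auto
    then show False by (simp add: divide_less_0_iff)
  qed
  then show ?thesis unfolding curv_def by (simp only: sum.empty)
qed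

lemma radau_cell:
  assumes k: "k < n" and curv: "0 \<le> n * curv (real k / n)" "n * curv (real k / n) \<le> sqrt 3 / 6"
  defines "A \<equiv> real k / real n"
  shows "0 \<le> n * (curv A + 1 / n - (\<Sum>i\<in>cell k. a i))"
    and "n * (curv A + 1 / n - (\<Sum>i\<in>cell k. a i)) \<le> sqrt 3 / 6"
    and "0 \<le> s \<Longrightarrow> s \<le> 1 \<Longrightarrow> 0 \<le> M 2 (A + s / n) \<and> M 2 (A + s / n) \<le> sqrt 3 / (108 * real n ^ 3)"
proof -
  obtain i where i: "cell k = {i}" using cells_exhaust(1)[OF k] by (auto simp: card_1_singleton_iff)
  \<comment> \<open>Lengths and weights scale by \<open>n\<close>, and so does the second
    derivative; \<open>M 2\<close> itself scales by \<open>n ^ 3\<close>.\<close>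
  define c where "c = n * curv A"
  define b where "b = n * a i"
  define \<theta> where "\<theta> = n * (\<tau> i - A)"
  have n0: "real n > 0" using n by simp
  have ti: "\<tau> i = A + \<theta> / n" and ai: "a i = b / n" and ci: "curv A = c / n"
    using n0 by (auto simp: \<theta>_def b_def c_def)
  have "i \<in> cell k" by (simp add: i)
  then have "0 < \<tau> i - A" "\<tau> i - A < 1 / n"
    unfolding cell_def A_def knot_Suc[symmetric] by auto
  then have \<theta>: "0 < \<theta>" "\<theta> < 1"
    using n0 by (auto simp: \<theta>_def pos_less_divide_eq mult.commute)
  have B: "real (Suc k) / real n - \<tau> i = (1 - \<theta>) / n"
    unfolding ti knot_Suc[symmetric] A_def by (simp add: diff_divide_distrib)
  have "curv A / (2 * real n ^ 2) + 1 / (6 * real n ^ 3) = a i * (real (Suc k) / real n - \<tau> i)\<^sup>2 / 2"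
    "curv A / n + 1 / (2 * real n ^ 2) = a i * (real (Suc k) / real n - \<tau> i)"
    using cell_equations[OF k] by (simp_all add: i A_def)
  note eqs = this[unfolded B ci ai]
  have eq1: "c / 2 + 1 / 6 - b * (1 - \<theta>)\<^sup>2 / 2 = 0"
  proof -
    have "(c / 2 + 1 / 6 - b * (1 - \<theta>)\<^sup>2 / 2) / real n ^ 3 =
        c / n / (2 * real n ^ 2) + 1 / (6 * real n ^ 3) - b / n * ((1 - \<theta>) / n)\<^sup>2 / 2"
      using n0 by (simp add: power2_eq_square power3_eq_cube field_simps)
    then show ?thesis using eqs(1) n0 by simp
  qed
  have eq2: "c + 1 / 2 - b * (1 - \<theta>) = 0"
  proof -
    have "(c + 1 / 2 - b * (1 - \<theta>)) / real n ^ 2 =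
        c / n / n + 1 / (2 * real n ^ 2) - b / n * ((1 - \<theta>) / n)"
      using n0 by (simp add: power2_eq_square field_simps)
    then show ?thesis using eqs(2) n0 by simp
  qed
  have "0 \<le> c" "c \<le> sqrt 3 / 6" using curv by (auto simp: c_def A_def)
  note step = radau_local_step[OF this \<theta> eq1 eq2]
  have "n * (curv A + 1 / n - (\<Sum>i\<in>cell k. a i)) = c + 1 - b"
    using n0 by (simp add: i ai ci field_simps)
  then show "0 \<le> n * (curv A + 1 / n - (\<Sum>i\<in>cell k. a i))"
    "n * (curv A + 1 / n - (\<Sum>i\<in>cell k. a i)) \<le> sqrt 3 / 6"
    using step(1,2) by auto
  assume s: "0 \<le> s" "s \<le> 1"
  have mx: "max 0 (A + s / n - \<tau> i) = max 0 (s - \<theta>) / n"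
    using n0 by (auto simp: ti max_def field_simps)
  have "M 2 (A + s / n) = curv A * (s / n)\<^sup>2 / 2 + (s / n) ^ 3 / 6
      - a i * (max 0 (A + s / n - \<tau> i))\<^sup>2 / 2"
    using monospline_on_cell(1)[OF k s] by (simp add: i A_def)
  also have "\<dots> = (c * s\<^sup>2 / 2 + s ^ 3 / 6 - b * (max 0 (s - \<theta>))\<^sup>2 / 2) / real n ^ 3"
    unfolding mx ai ci using n0 by (simp add: power2_eq_square power3_eq_cube field_simps)
  finally have "M 2 (A + s / n) =
      (c * s\<^sup>2 / 2 + s ^ 3 / 6 - b * (max 0 (s - \<theta>))\<^sup>2 / 2) / real n ^ 3" .
  moreover have "0 \<le> c * s\<^sup>2 / 2 + s ^ 3 / 6 - b * (max 0 (s - \<theta>))\<^sup>2 / 2"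
    "c * s\<^sup>2 / 2 + s ^ 3 / 6 - b * (max 0 (s - \<theta>))\<^sup>2 / 2 \<le> sqrt 3 / 108"
    using step(3,4)[OF s] by auto
  ultimately show "0 \<le> M 2 (A + s / n) \<and> M 2 (A + s / n) \<le> sqrt 3 / (108 * real n ^ 3)"
    using n0 by (simp add: divide_right_mono[of _ "sqrt 3 / 108" "real n ^ 3", simplified])
qed

lemma curv_bounds:
  "k < n \<Longrightarrow> 0 \<le> n * curv (real k / n) \<and> n * curv (real k / n) \<le> sqrt 3 / 6"
proof (induction k)
  case 0
  then show ?case by (simp add: curv_0)
next
  case (Suc k)
  then show ?case using radau_cell(1,2)[of k] curv_Suc[of k] by simp
qed

end

lemma knot_interval:
  fixes t :: real
  assumes "n \<ge> 1" "0 \<le> t" "t \<le> 1"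
  obtains k s where "k < n" "0 \<le> s" "s \<le> 1" "t = real k / real n + s / real n"
proof (cases "t = 1")
  case True
  \<comment> \<open>Here the floor of \<open>n * t\<close> is \<open>n\<close>, which indexes no
    cell; the right end of the last cell is taken instead.\<close>
  show ?thesis
    by (rule that[of "n - 1" 1]) (use assms True in \<open>auto simp: field_simps of_nat_diff\<close>)
next
  case False
  define k where "k = nat \<lfloor>n * t\<rfloor>"
  have nt: "0 \<le> n * t" "n * t < n" using assms False by auto
  then have "real k = of_int \<lfloor>n * t\<rfloor>" by (simp add: k_def)
  then have k: "real k \<le> n * t" "n * t < real k + 1" by linarith+
  then have "k < n" using nt by linarith
  show ?thesis
    by (rule that[of k "n * t - k"])
      (use k nt assms \<open>k < n\<close> in \<open>auto simp: field_simps\<close>)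
qed

lemma (in radau_rule) kernel_bounds:
  assumes "t \<in> {0..1}"
  shows "0 \<le> M 2 t \<and> M 2 t \<le> sqrt 3 / (108 * real n ^ 3)"
proof -
  obtain k s where "k < n" "0 \<le> s" "s \<le> 1" "t = real k / real n + s / real n"
    using knot_interval[of n t] assms n unfolding atLeastAtMost_iff by blast
  then show ?thesis using radau_cell(3)[of k s] curv_bounds[of k] by simp
qed

section \<open>The Gauss rule\<close>

text \<open>The subtracted bracket is the cubic Hermite interpolant of the truncated cube at
  \<open>A\<close> and \<open>A + h\<close>. For \<open>c\<close> outside the cell the function is a
  cubic there and the error vanishes; for \<open>c\<close> inside, the error factors into
  nonnegative terms.\<close>

lemma hermite_error_truncated_cube_nonneg:
  fixes A h s c :: real
  assumes h: "0 < h" and s: "0 \<le> s" "s \<le> 1"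
  shows "0 \<le> max 0 (A + h * s - c) ^ 3
      - (max 0 (A - c) ^ 3 * ((1 + 2 * s) * (1 - s)\<^sup>2) + 3 * (max 0 (A - c))\<^sup>2 * (h * s * (1 - s)\<^sup>2)
       + max 0 (A + h - c) ^ 3 * (s\<^sup>2 * (3 - 2 * s)) - 3 * (max 0 (A + h - c))\<^sup>2 * (h * s\<^sup>2 * (1 - s)))"
proof -
  define \<theta> where "\<theta> = (c - A) / h"
  have c: "c = A + h * \<theta>" using h by (simp add: \<theta>_def)
  have m: "max 0 (h * x) = h * max 0 x" for x using h by (auto simp: max_def zero_le_mult_iff)
  have e: "A + h * s - c = h * (s - \<theta>)" "A - c = h * (- \<theta>)" "A + h - c = h * (1 - \<theta>)"
    by (auto simp: c algebra_simps)
  define E where "E = max 0 (s - \<theta>) ^ 3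
      - (max 0 (- \<theta>) ^ 3 * ((1 + 2 * s) * (1 - s)\<^sup>2) + 3 * (max 0 (- \<theta>))\<^sup>2 * (s * (1 - s)\<^sup>2)
       + max 0 (1 - \<theta>) ^ 3 * (s\<^sup>2 * (3 - 2 * s)) - 3 * (max 0 (1 - \<theta>))\<^sup>2 * (s\<^sup>2 * (1 - s)))"
  have "0 \<le> E"
  proof -
    consider "\<theta> \<le> 0" | "0 < \<theta>" "\<theta> < s" | "0 < \<theta>" "s \<le> \<theta>" "\<theta> < 1" | "1 \<le> \<theta>" by linarith
    then show ?thesis
    proof cases
      case 1
      then have "E = (s - \<theta>) ^ 3
      - ((- \<theta>) ^ 3 * ((1 + 2 * s) * (1 - s)\<^sup>2) + 3 * (- \<theta>)\<^sup>2 * (s * (1 - s)\<^sup>2)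
       + (1 - \<theta>) ^ 3 * (s\<^sup>2 * (3 - 2 * s)) - 3 * (1 - \<theta>)\<^sup>2 * (s\<^sup>2 * (1 - s)))"
        unfolding E_def using s by (simp add: max_def)
      also have "\<dots> = 0" by (simp add: power2_eq_square power3_eq_cube algebra_simps)
      finally show ?thesis by simp
    next
      case 2
      then have "E = (s - \<theta>) ^ 3 - ((1 - \<theta>) ^ 3 * (s\<^sup>2 * (3 - 2 * s)) - 3 * (1 - \<theta>)\<^sup>2 * (s\<^sup>2 * (1 - s)))"
        unfolding E_def using s by (simp add: max_def)
      also have "\<dots> = (\<theta> * (1 - s))\<^sup>2 * (2 * (s * (1 - \<theta>)) + (s - \<theta>))"
        by (simp add: power2_eq_square power3_eq_cube algebra_simps)
      finally show ?thesis using 2 s by simp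
    next
      case 3
      then have "E = 3 * (1 - \<theta>)\<^sup>2 * (s\<^sup>2 * (1 - s)) - (1 - \<theta>) ^ 3 * (s\<^sup>2 * (3 - 2 * s))"
        unfolding E_def using s by (simp add: max_def)
      also have "\<dots> = ((1 - \<theta>) * s)\<^sup>2 * (2 * (\<theta> * (1 - s)) + (\<theta> - s))"
        by (simp add: power2_eq_square power3_eq_cube algebra_simps)
      finally show ?thesis using 3 s by simp
    next
      case 4
      then show ?thesis unfolding E_def using s by (simp add: max_def)
    qed
  qed
  then have "0 \<le> h ^ 3 * E" using h by simp
  then show ?thesis
    unfolding e m E_def by (simp add: power_mult_distrib power2_eq_square power3_eq_cube algebra_simps)
qed

locale gauss_rule = spline_exact_rule n 3 I a \<tau> for n and I :: "'i set" and a \<tau> +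
  assumes card_I: "card I = Suc n" and inner: "\<And>i. i \<in> I \<Longrightarrow> 0 < \<tau> i \<and> \<tau> i < 1"
begin

text \<open>\<open>M 1\<close> is the second derivative of the Peano kernel \<open>M 3\<close>; it is strictly convex between
  consecutive nodes of positive weight.\<close>

lemma positive_node_between:
  assumes uwv: "u < w" "w < v" and le: "M 1 u \<le> M 1 w" "M 1 v \<le> M 1 w"
  obtains i where "i \<in> I" "0 < a i" "u < \<tau> i" "\<tau> i < v"
proof (rule ccontr)
  assume "\<not> thesis"
  note found = that
  have none: "a i \<le> 0 \<or> \<tau> i \<le> u \<or> v \<le> \<tau> i" if "i \<in> I" for i
    using found[of i] that \<open>\<not> thesis\<close> by (meson not_le)
  define l where "l = (v - w) / (v - u)"
  have l: "0 < l" "l < 1" using uwv by (auto simp: l_def)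
  have "l * (v - u) = v - w" using uwv by (simp add: l_def)
  then have w: "w = l * u + (1 - l) * v" by (simp add: algebra_simps)
  \<comment> \<open>On \<open>{u..v}\<close> each term is affine if its node lies outside, and
    concave if its weight is nonpositive.\<close>
  have "a i * (l * max 0 (u - \<tau> i) + (1 - l) * max 0 (v - \<tau> i)) \<le> a i * max 0 (w - \<tau> i)"
    if "i \<in> I" for i
  proof -
    have w': "w - \<tau> i = l * (u - \<tau> i) + (1 - l) * (v - \<tau> i)" by (simp add: w algebra_simps)
    consider "a i \<le> 0" | "\<tau> i \<le> u" | "v \<le> \<tau> i" using none[OF \<open>i \<in> I\<close>] by blast
    then show ?thesis
    proof cases
      case 1
      have "l * (u - \<tau> i) \<le> l * max 0 (u - \<tau> i)" "(1 - l) * (v - \<tau> i) \<le> (1 - l) * max 0 (v - \<tau> i)"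
        "0 \<le> l * max 0 (u - \<tau> i)" "0 \<le> (1 - l) * max 0 (v - \<tau> i)"
        using l by (auto intro: mult_left_mono)
      then have "max 0 (w - \<tau> i) \<le> l * max 0 (u - \<tau> i) + (1 - l) * max 0 (v - \<tau> i)"
        using w' by linarith
      then show ?thesis using 1 by (rule mult_left_mono_neg)
    next
      case 2
      then show ?thesis using uwv w' by (simp add: max_def)
    next
      case 3
      then show ?thesis using uwv by (simp add: max_def)
    qed
  qed
  then have "(\<Sum>i\<in>I. a i * (l * max 0 (u - \<tau> i) + (1 - l) * max 0 (v - \<tau> i)))
      \<le> (\<Sum>i\<in>I. a i * max 0 (w - \<tau> i))"
    by (rule sum_mono)
  moreover have "(\<Sum>i\<in>I. a i * (l * max 0 (u - \<tau> i) + (1 - l) * max 0 (v - \<tau> i))) =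
      l * (\<Sum>i\<in>I. a i * max 0 (u - \<tau> i)) + (1 - l) * (\<Sum>i\<in>I. a i * max 0 (v - \<tau> i))"
    by (simp add: sum_distrib_left sum.distrib[symmetric] algebra_simps)
  \<comment> \<open>The quadratic part of \<open>M 1\<close> supplies the strictness.\<close>
  moreover have "w\<^sup>2 / 2 < l * (u\<^sup>2 / 2) + (1 - l) * (v\<^sup>2 / 2)"
  proof -
    have "0 < l * (1 - l) * (v - u)\<^sup>2 / 2" using l uwv by simp
    also have "\<dots> = l * (u\<^sup>2 / 2) + (1 - l) * (v\<^sup>2 / 2) - w\<^sup>2 / 2"
      unfolding w by (simp add: power2_eq_square field_simps)
    finally show ?thesis by simp
  qed
  ultimately have "M 1 w < l * M 1 u + (1 - l) * M 1 v"
    by (simp add: monospline_def power2_eq_square[symmetric] right_diff_distrib)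
  also have "\<dots> \<le> l * M 1 w + (1 - l) * M 1 w"
    using l le by (intro add_mono mult_left_mono) auto
  finally show False by (simp add: algebra_simps)
qed

text \<open>It grows strictly across any interval with an interior value of \<open>M 1\<close> no
  smaller than both end values, so chaining such intervals counts nodes of positive weight.\<close>

definition pos_count :: "real \<Rightarrow> nat" where
  "pos_count t = card {i\<in>I. 0 < a i \<and> \<tau> i < t}"

lemma pos_count_less:
  assumes "u < w" "w < v" "M 1 u \<le> M 1 w" "M 1 v \<le> M 1 w"
  shows "pos_count u < pos_count v"
proof -
  obtain i where "i \<in> I" "0 < a i" "u < \<tau> i" "\<tau> i < v"
    using positive_node_between[OF assms] by blast
  then have "{i\<in>I. 0 < a i \<and> \<tau> i < u} \<subset> {i\<in>I. 0 < a i \<and> \<tau> i < v}"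
    using assms by force
  then show ?thesis unfolding pos_count_def using finite_I by (intro psubset_card_mono) auto
qed

lemma pos_count_le: "pos_count t \<le> Suc n"
  unfolding pos_count_def card_I[symmetric] by (rule card_mono) (use finite_I in auto)

text \<open>Before the first node \<open>M 1\<close> is \<open>w\<^sup>2 / 2\<close>. This provides
  the interior point for a counting interval that starts at 0; \<open>M1_near_1\<close> does the
  same at the other end, where the moments give \<open>(1 - w)\<^sup>2 / 2\<close>.\<close>

lemma M1_near_0:
  assumes "0 < t"
  obtains w where "0 < w" "w < t" "0 < M 1 w" "M 1 0 = 0"
proof -
  define b where "b = Min (insert t (\<tau> ` I))"
  have b: "0 < b" "b \<le> t" "\<And>i. i \<in> I \<Longrightarrow> b \<le> \<tau> i"
    unfolding b_def using finite_I assms inner by auto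
  have val: "M 1 w = w\<^sup>2 / 2" if "w \<le> b" for w
  proof -
    have "(\<Sum>i\<in>I. a i * max 0 (w - \<tau> i)) = 0"
      by (rule sum.neutral) (use b that in \<open>force simp: max_def\<close>)
    then show ?thesis by (simp add: monospline_def power2_eq_square)
  qed
  have "0 < M 1 (b / 2)" by (subst val) (use b in auto)
  moreover have "M 1 0 = 0" by (subst val) (use b in auto)
  ultimately show ?thesis using that[of "b / 2"] b by simp
qed

lemma M1_near_1:
  assumes "t < 1"
  obtains w where "t < w" "w < 1" "0 < M 1 w" "M 1 1 = 0"
proof -
  define b where "b = Max (insert t (\<tau> ` I))"
  have b: "b < 1" "t \<le> b" "\<And>i. i \<in> I \<Longrightarrow> \<tau> i \<le> b"
    unfolding b_def using finite_I assms inner by auto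
  have val: "M 1 w = (1 - w)\<^sup>2 / 2" if "b \<le> w" for w
  proof -
    have "(\<Sum>i\<in>I. a i * max 0 (w - \<tau> i)) = (\<Sum>i\<in>I. a i * (w - \<tau> i))"
      by (rule sum.cong) (use b that in \<open>force simp: max_def\<close>)+
    also have "\<dots> = w * (\<Sum>i\<in>I. a i * \<tau> i ^ 0) - (\<Sum>i\<in>I. a i * \<tau> i ^ 1)"
      by (simp add: right_diff_distrib sum_subtractf sum_distrib_left mult.commute)
    also have "\<dots> = w - 1 / 2" using moments[of 0] moments[of 1] by simp
    finally show ?thesis by (simp add: monospline_def power2_eq_square field_simps)
  qed
  have "0 < M 1 ((1 + b) / 2)" by (subst val) (use b in auto)
  moreover have "M 1 1 = 0" by (subst val) (use b in auto)
  ultimately show ?thesis using that[of "(1 + b) / 2"] b by simp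
qed

section \<open>Zeros of the second derivative, signs of the weights, bounds on the kernel\<close>

abbreviation "knot k \<equiv> real k / real n"

lemma knot_less: "knot k < knot (Suc k)"
  using n by (simp add: divide_strict_right_mono)

lemma M_derivative:
  "(M 3 has_real_derivative M 2 t) (at t)" "(M 2 has_real_derivative M 1 t) (at t)"
  using monospline_derivative[of 2] monospline_derivative[of 1] by (simp_all add: numeral_eq_Suc)

lemma M3_mvt:
  assumes "u < v"
  obtains z where "u < z" "z < v" "M 3 v - M 3 u = (v - u) * M 2 z"
  using MVT2[OF assms, of "M 3" "M 2"] M_derivative by blast

lemma M2_mvt:
  assumes "u < v"
  obtains z where "u < z" "z < v" "M 2 v - M 2 u = (v - u) * M 1 z"
  using MVT2[OF assms, of "M 2" "M 1"] M_derivative by blast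

lemma M_at_knot:
  assumes "k \<le> n" shows "M 3 (knot k) = 0" "M 2 (knot k) = 0"
  using monospline_at_knot[OF assms] by auto

text \<open>Rolle for \<open>M 3\<close> between the knots, then for \<open>M 2\<close> on either
  side of the zero found.\<close>

lemma two_zeros:
  assumes "k < n"
  obtains z z' where "knot k < z" "z < z'" "z' < knot (Suc k)" "M 1 z = 0" "M 1 z' = 0"
proof -
  obtain y where y: "knot k < y" "y < knot (Suc k)" "M 2 y = 0"
    using M3_mvt[OF knot_less[of k]] M_at_knot[of k] M_at_knot[of "Suc k"] assms knot_less[of k]
    by (metis Suc_leI diff_self less_imp_le mult_eq_0_iff right_minus_eq less_irrefl)
  obtain z where z: "knot k < z" "z < y" "M 1 z = 0"
    using M2_mvt[OF y(1)] M_at_knot[of k] y assms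
    by (metis diff_self less_imp_le mult_eq_0_iff right_minus_eq less_irrefl)
  obtain z' where z': "y < z'" "z' < knot (Suc k)" "M 1 z' = 0"
    using M2_mvt[OF y(2)] M_at_knot[of "Suc k"] y assms
    by (metis Suc_leI diff_self mult_eq_0_iff right_minus_eq less_irrefl)
  show ?thesis using that[of z z'] z z' by simp
qed

text \<open>Each new cell adds a positive node: the second zero of the previous cell is the interior
  point between the first zeros of the two cells.\<close>

lemma zeros_with_count:
  "k < n \<Longrightarrow> \<exists>z z'. 0 < z \<and> z < z' \<and> z' < knot (Suc k) \<and> M 1 z = 0 \<and> M 1 z' = 0 \<and> Suc k \<le> pos_count z"
proof (induction k)
  case 0
  obtain z z' where z: "knot 0 < z" "z < z'" "z' < knot (Suc 0)" "M 1 z = 0" "M 1 z' = 0"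
    using two_zeros[OF 0] by blast
  obtain w where "0 < w" "w < z" "0 < M 1 w" "M 1 0 = 0" using M1_near_0[of z] z by auto
  then have "pos_count 0 < pos_count z" using pos_count_less[of 0 w z] z by simp
  then show ?case using z by (intro exI[of _ z] exI[of _ z']) auto
next
  case (Suc k)
  then obtain y y' where y: "0 < y" "y < y'" "y' < knot (Suc k)" "M 1 y = 0" "M 1 y' = 0"
      "Suc k \<le> pos_count y"
    by auto
  obtain z z' where z: "knot (Suc k) < z" "z < z'" "z' < knot (Suc (Suc k))" "M 1 z = 0" "M 1 z' = 0"
    using two_zeros[OF Suc.prems] by blast
  have "pos_count y < pos_count z" using pos_count_less[of y y' z] y z by simp
  then show ?case using y z by (intro exI[of _ z] exI[of _ z']) auto
qed

text \<open>The last cell has \<open>n\<close> positive nodes before its first zero, and its second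
  zero separates the first from 1, giving one more. That accounts for all \<open>n + 1\<close>
  nodes.\<close>

lemma weights_pos:
  assumes "i \<in> I" shows "0 < a i"
proof -
  obtain z z' where z: "0 < z" "z < z'" "z' < knot n" "M 1 z = 0" "M 1 z' = 0" "n \<le> pos_count z"
    using zeros_with_count[of "n - 1"] n by auto
  obtain w where "M 1 1 = 0" using M1_near_1[of 0] by auto
  then have "pos_count z < pos_count 1" using pos_count_less[of z z' 1] z n by simp
  then have "card I \<le> card {i\<in>I. 0 < a i \<and> \<tau> i < 1}"
    using z card_I by (simp add: pos_count_def)
  then have "{i\<in>I. 0 < a i \<and> \<tau> i < 1} = I"
    by (intro card_seteq finite_I) auto
  then show ?thesis using assms by blast
qed

text \<open>A negative value of \<open>M 3\<close> in a cell makes \<open>M 1\<close> take the signs \<open>-\<close>, \<open>+\<close>, \<open>-\<close> there, which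
  forces one node more than the rule has.\<close>

lemma kernel_nonneg_cell:
  assumes k: "k < n" and t: "knot k < t" "t < knot (Suc k)"
  shows "0 \<le> M 3 t"
proof (rule ccontr)
  assume "\<not> 0 \<le> M 3 t"
  then have neg: "M 3 t < 0" by simp
  obtain p where p: "knot k < p" "p < t" "M 3 t - M 3 (knot k) = (t - knot k) * M 2 p"
    using M3_mvt[OF t(1)] by blast
  have p2: "M 2 p < 0"
    using neg p M_at_knot[of k] k t by (auto simp: mult_less_0_iff)
  obtain q where q: "t < q" "q < knot (Suc k)" "M 3 (knot (Suc k)) - M 3 t = (knot (Suc k) - t) * M 2 q"
    using M3_mvt[OF t(2)] by blast
  have "0 < (knot (Suc k) - t) * M 2 q" using neg q(3) M_at_knot[of "Suc k"] k by simp
  then have q2: "0 < M 2 q" using t by (simp add: zero_less_mult_iff)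
  obtain u where u: "knot k < u" "u < p" "M 2 p - M 2 (knot k) = (p - knot k) * M 1 u"
    using M2_mvt[OF p(1)] by blast
  have u1: "M 1 u < 0" using p2 u M_at_knot[of k] k p by (auto simp: mult_less_0_iff)
  obtain v where v: "q < v" "v < knot (Suc k)" "M 2 (knot (Suc k)) - M 2 q = (knot (Suc k) - q) * M 1 v"
    using M2_mvt[OF q(2)] by blast
  have "(knot (Suc k) - q) * M 1 v < 0" using q2 v(3) M_at_knot[of "Suc k"] k by simp
  then have v1: "M 1 v < 0" using q by (simp add: mult_less_0_iff)
  obtain w where w: "p < w" "w < q" "M 2 q - M 2 p = (q - p) * M 1 w"
    using M2_mvt[of p q] p q by (metis less_trans)
  have "0 < (q - p) * M 1 w" using p2 q2 w(3) by simp
  then have w1: "0 < M 1 w" using p q by (simp add: zero_less_mult_iff)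
  \<comment> \<open>The \<open>k\<close> earlier cells give \<open>k\<close> positive nodes, and the
    approach to \<open>u\<close> gives another.\<close>
  have "k < pos_count u"
  proof (cases k)
    case 0
    obtain x where "0 < x" "x < u" "0 < M 1 x" "M 1 0 = 0" using M1_near_0[of u] u 0 by auto
    then have "pos_count 0 < pos_count u" using pos_count_less[of 0 x u] u1 by simp
    then show ?thesis using 0 by simp
  next
    case (Suc j)
    then obtain z z' where z: "0 < z" "z < z'" "z' < knot k" "M 1 z = 0" "M 1 z' = 0" "k \<le> pos_count z"
      using zeros_with_count[of j] k by auto
    then have "pos_count z < pos_count u" using pos_count_less[of z z' u] u u1 by simp
    then show ?thesis using z by simp
  qed
  moreover have "pos_count u < pos_count v"
    using pos_count_less[of u w v] u v w u1 v1 w1 by simp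
  ultimately have start: "Suc (Suc k) \<le> pos_count v" by simp
  \<comment> \<open>To the right of \<open>v\<close> the roles switch: in each later cell the first
    zero is the interior point and the second zero the new end point.\<close>
  have "\<exists>v. v < knot j \<and> M 1 v \<le> 0 \<and> Suc j \<le> pos_count v" if "Suc k \<le> j" "j \<le> n" for j
    using that
  proof (induction j rule: dec_induct)
    case base
    then show ?case using v v1 start by (intro exI[of _ v]) auto
  next
    case (step j)
    then obtain v where v: "v < knot j" "M 1 v \<le> 0" "Suc j \<le> pos_count v" by auto
    obtain z z' where z: "knot j < z" "z < z'" "z' < knot (Suc j)" "M 1 z = 0" "M 1 z' = 0"
      using two_zeros[of j] step by auto
    have "pos_count v < pos_count z'" using pos_count_less[of v z z'] v z by simp
    then show ?case using v z by (intro exI[of _ z']) auto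
  qed
  from this[of n] k n obtain v where v: "v < 1" "M 1 v \<le> 0" "Suc n \<le> pos_count v" by auto
  \<comment> \<open>The approach to 1 adds one more, making \<open>n + 2\<close> positive
    nodes.\<close>
  obtain w where "v < w" "w < 1" "0 < M 1 w" "M 1 1 = 0" using M1_near_1[OF v(1)] by blast
  then have "pos_count v < pos_count 1" using pos_count_less[of v w 1] v by simp
  with v pos_count_le[of 1] show False by simp
qed

lemma kernel_upper:
  assumes k: "k < n" and s: "0 \<le> s" "s \<le> 1"
  shows "M 3 (knot k + s / n) \<le> 1 / (384 * real n ^ 4)"
proof -
  \<comment> \<open>\<open>H F F'\<close> is the error of cubic Hermite interpolation in the cell. It fixes \<open>M 3\<close>, which
    has double zeros at the knots, and each node of positive weight can only decrease it.\<close>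
  define h where "h = 1 / real n"
  define A where "A = knot k"
  have h: "0 < h" using n by (simp add: h_def)
  have B: "A + h = knot (Suc k)" by (simp add: A_def h_def add_divide_distrib)
  define H where "H = (\<lambda>F F'. F (A + h * s) - (F A * ((1 + 2 * s) * (1 - s)\<^sup>2) + F' A * (h * s * (1 - s)\<^sup>2)
       + F (A + h) * (s\<^sup>2 * (3 - 2 * s)) - F' (A + h) * (h * s\<^sup>2 * (1 - s)))) "
  have M3: "M 3 t = t ^ 4 / 24 - (\<Sum>i\<in>I. a i / 6 * max 0 (t - \<tau> i) ^ 3)" for t
    by (simp add: monospline_def fact_numeral eval_nat_numeral sum_divide_distrib)
  have M2: "M 2 t = t ^ 3 / 6 - (\<Sum>i\<in>I. a i / 6 * (3 * (max 0 (t - \<tau> i))\<^sup>2))" for t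
    by (simp add: monospline_def fact_numeral eval_nat_numeral sum_divide_distrib)
  have "M 3 (A + h * s) = H (M 3) (M 2)"
    using M_at_knot[of k] M_at_knot[of "Suc k"] k unfolding H_def B by (simp add: A_def)
  \<comment> \<open>\<open>H\<close> is linear in the pair of function and derivative, so it splits
    along the monospline.\<close>
  also have "\<dots> = H (\<lambda>t. t ^ 4 / 24) (\<lambda>t. t ^ 3 / 6)
      - (\<Sum>i\<in>I. a i / 6 * H (\<lambda>t. max 0 (t - \<tau> i) ^ 3) (\<lambda>t. 3 * (max 0 (t - \<tau> i))\<^sup>2))"
    unfolding H_def M3 M2
    by (simp add: sum_subtractf sum.distrib right_diff_distrib left_diff_distrib distrib_left
        distrib_right sum_distrib_right sum_distrib_left diff_divide_distrib sum_negf mult_ac)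
  also have "\<dots> \<le> H (\<lambda>t. t ^ 4 / 24) (\<lambda>t. t ^ 3 / 6)"
  proof -
    have "0 \<le> H (\<lambda>t. max 0 (t - \<tau> i) ^ 3) (\<lambda>t. 3 * (max 0 (t - \<tau> i))\<^sup>2)" for i
      using hermite_error_truncated_cube_nonneg[OF h s, of A "\<tau> i"] unfolding H_def .
    then show ?thesis using weights_pos by (auto intro!: sum_nonneg mult_nonneg_nonneg simp: less_imp_le)
  qed
  \<comment> \<open>The fourth derivative of \<open>t ^ 4 / 24\<close> is 1, so the Hermite error is
    the product of the squared distances to the knots over 24. At the midpoint this is
    \<open>h ^ 4 / 384\<close>.\<close>
  also have "\<dots> = h ^ 4 * (s * (1 - s))\<^sup>2 / 24"
    unfolding H_def by (simp add: eval_nat_numeral field_simps)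
  also have "\<dots> \<le> h ^ 4 * (1 / 4)\<^sup>2 / 24"
  proof -
    have "0 \<le> (s - 1 / 2)\<^sup>2" by simp
    then have "s * (1 - s) \<le> 1 / 4" by (simp add: power2_eq_square algebra_simps)
    then have "(s * (1 - s))\<^sup>2 \<le> (1 / 4)\<^sup>2" using s by (intro power_mono) auto
    then show ?thesis using h by (intro divide_right_mono mult_left_mono) auto
  qed
  finally show ?thesis by (simp add: A_def h_def power_divide power2_eq_square)
qed

lemma kernel_bounds:
  assumes "t \<in> {0..1}"
  shows "0 \<le> M 3 t \<and> M 3 t \<le> 1 / (384 * real n ^ 4)"
proof -
  obtain k s where ks: "k < n" "0 \<le> s" "s \<le> 1" "t = real k / real n + s / real n"
    using knot_interval[of n t] assms n unfolding atLeastAtMost_iff by blast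
  have "0 \<le> M 3 t"
  proof (cases "s = 0 \<or> s = 1")
    case True
    then have "t = knot k \<or> t = knot (Suc k)" using ks by (auto simp: add_divide_distrib)
    then show ?thesis using M_at_knot[of k] M_at_knot[of "Suc k"] ks by auto
  next
    case False
    then have "knot k < t" "t < knot (Suc k)" using ks n by (auto simp: field_simps)
    then show ?thesis using kernel_nonneg_cell ks by blast
  qed
  then show ?thesis using kernel_upper[of k s] ks by simp
qed

end

section \<open>The error bounds\<close>

lemma right_radau_rule:
  assumes n: "n \<ge> 1" and Q: "is_right_radau n Q"
  obtains a \<tau> where "radau_rule n {..n} a \<tau>" "Q = (\<lambda>f. \<Sum>k\<le>n. a k * f (\<tau> k))"
proof -
  obtain a \<tau> where \<tau>: "\<forall>k<n. 0 < \<tau> k \<and> \<tau> k < 1"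
    and Q_eq: "Q = (\<lambda>f. (\<Sum>k<n. a k * f (\<tau> k)) + a n * f 1)"
    and exact: "\<forall>f\<in>spline_space n 3. remainder Q f = 0"
    using Q unfolding is_right_radau_def by blast
  \<comment> \<open>Index \<open>n\<close> receives the prescribed node 1, so that the rule becomes
    a single sum over \<open>{..n}\<close>.\<close>
  define \<sigma> where "\<sigma> = \<tau>(n := 1)"
  have Q_eq': "Q = (\<lambda>f. \<Sum>k\<le>n. a k * f (\<sigma> k))"
    unfolding Q_eq \<sigma>_def by (simp add: lessThan_Suc_atMost[symmetric])
  have "radau_rule n {..n} a \<sigma>"
  proof
    show "0 \<le> \<sigma> i \<and> \<sigma> i \<le> 1" if "i \<in> {..n}" for i
      using that \<tau> by (auto simp: \<sigma>_def less_imp_le)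
    show "(\<Sum>i\<le>n. a i * f (\<sigma> i)) = integral {0..1} f" if "f \<in> spline_space n (Suc 2)" for f
      using exact that by (simp add: remainder_def Q_eq' numeral_3_eq_3 numeral_2_eq_2)
    have "{i \<in> {..n}. \<sigma> i < 1} \<subseteq> {..<n}" by (auto simp: \<sigma>_def split: if_splits)
    then show "card {i \<in> {..n}. \<sigma> i < 1} \<le> n" using card_mono[of "{..<n}"] by fastforce
  qed (use n in auto)
  then show ?thesis using that Q_eq' by blast
qed

lemma gauss_rule_of_is_gauss:
  assumes n: "n \<ge> 1" and Q: "is_gauss n Q"
  obtains a \<tau> where "gauss_rule n {1..n+1} a \<tau>" "Q = (\<lambda>f. \<Sum>i=1..n+1. a i * f (\<tau> i))"
proof -
  obtain a \<tau> where \<tau>: "\<forall>i\<in>{1..n+1}. 0 < \<tau> i \<and> \<tau> i < 1"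
    and Q_eq: "Q = (\<lambda>f. \<Sum>i=1..n+1. a i * f (\<tau> i))"
    and exact: "\<forall>f\<in>spline_space n 4. remainder Q f = 0"
    using Q unfolding is_gauss_def by blast
  have "gauss_rule n {1..n+1} a \<tau>"
  proof
    show "(\<Sum>i=1..n+1. a i * f (\<tau> i)) = integral {0..1} f" if "f \<in> spline_space n (Suc 3)" for f
      using exact that by (simp add: remainder_def Q_eq)
    show "0 \<le> \<tau> i \<and> \<tau> i \<le> 1" "0 < \<tau> i \<and> \<tau> i < 1" if "i \<in> {1..n+1}" for i
      using \<tau> that by (auto simp: less_imp_le)
  qed (use n in auto)
  then show ?thesis using that Q_eq by blast
qed

context
  fixes f :: "real \<Rightarrow> real" and n :: nat
  assumes n: "n \<ge> 1"
begin

lemma right_radau_bounds: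
  assumes f: "f \<in> C01 3" "\<And>x. x \<in> {0..1} \<Longrightarrow> 0 \<le> deriv01 3 f x" and Q: "is_right_radau n Q"
  shows "remainder Q f \<le> 0"
    and "sqrt 3 / (108 * real n ^ 3) * (deriv01 2 f 0 - deriv01 2 f 1) \<le> remainder Q f"
proof -
  obtain a \<tau> where "radau_rule n {..n} a \<tau>" and Q_eq: "Q = (\<lambda>f. \<Sum>k\<le>n. a k * f (\<tau> k))"
    using right_radau_rule[OF n Q] .
  then interpret radau_rule n "{..n}" a \<tau> by simp
  have f': "f \<in> C01 (Suc 2)" "\<And>x. x \<in> {0..1} \<Longrightarrow> 0 \<le> deriv01 (Suc 2) f x"
    using f by (simp_all add: numeral_3_eq_3 numeral_2_eq_2)
  \<comment> \<open>For \<open>m = 2\<close> the sign is -1, which negates and swaps the kernel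
    bounds.\<close>
  have "- (sqrt 3 / (108 * real n ^ 3)) \<le> (-1) ^ Suc 2 * M 2 t \<and> (-1) ^ Suc 2 * M 2 t \<le> 0"
    if "t \<in> {0..1}" for t
    using kernel_bounds[OF that] by simp
  note bounds = weighted_integral_bounds[OF f' this remainder_integral[OF f'(1)]]
  show "remainder Q f \<le> 0" using bounds(2) by (simp add: remainder_def Q_eq)
  have "sqrt 3 / (108 * real n ^ 3) * (deriv01 2 f 0 - deriv01 2 f 1) =
      - (sqrt 3 / (108 * real n ^ 3)) * (deriv01 2 f 1 - deriv01 2 f 0)"
    by (simp only: mult_minus_left mult_minus_right[symmetric] minus_diff_eq)
  then show "sqrt 3 / (108 * real n ^ 3) * (deriv01 2 f 0 - deriv01 2 f 1) \<le> remainder Q f"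
    using bounds(1) by (simp only: remainder_def Q_eq)
qed

lemma left_radau_bounds:
  assumes f: "f \<in> C01 3" "\<And>x. x \<in> {0..1} \<Longrightarrow> 0 \<le> deriv01 3 f x" and Q: "is_left_radau n Q"
  shows "0 \<le> remainder Q f"
    and "remainder Q f \<le> sqrt 3 / (108 * real n ^ 3) * (deriv01 2 f 1 - deriv01 2 f 0)"
proof -
  obtain Q' where Q': "is_right_radau n Q'" "Q = (\<lambda>f. Q' (\<lambda>x. f (1 - x)))"
    using Q unfolding is_left_radau_def by blast
  obtain a \<tau> where "radau_rule n {..n} a \<tau>" and "Q' = (\<lambda>f. \<Sum>k\<le>n. a k * f (\<tau> k))"
    using right_radau_rule[OF n Q'(1)] .
  then interpret radau_rule n "{..n}" a \<tau> by simp
  have Q_eq: "Q = (\<lambda>f. \<Sum>k\<le>n. a k * f (1 - \<tau> k))"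
    using Q'(2) \<open>Q' = _\<close> by simp
  have f': "f \<in> C01 (Suc 2)" "\<And>x. x \<in> {0..1} \<Longrightarrow> 0 \<le> deriv01 (Suc 2) f x"
    using f by (simp_all add: numeral_3_eq_3 numeral_2_eq_2)
  have "0 \<le> M 2 (1 - t) \<and> M 2 (1 - t) \<le> sqrt 3 / (108 * real n ^ 3)" if "t \<in> {0..1}" for t
    using kernel_bounds[of "1 - t"] that by simp
  note bounds = weighted_integral_bounds[OF f' this reflected_remainder_integral[OF f'(1)]]
  show "0 \<le> remainder Q f" using bounds(1) by (simp add: remainder_def Q_eq)
  show "remainder Q f \<le> sqrt 3 / (108 * real n ^ 3) * (deriv01 2 f 1 - deriv01 2 f 0)"
    using bounds(2) by (simp only: remainder_def Q_eq)
qed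

lemma gauss_bounds:
  assumes f: "f \<in> C01 4" "\<And>x. x \<in> {0..1} \<Longrightarrow> 0 \<le> deriv01 4 f x" and Q: "is_gauss n Q"
  shows "0 \<le> remainder Q f"
    and "remainder Q f \<le> 1 / (384 * real n ^ 4) * (deriv01 3 f 1 - deriv01 3 f 0)"
proof -
  obtain a \<tau> where "gauss_rule n {1..n+1} a \<tau>" and Q_eq: "Q = (\<lambda>f. \<Sum>i=1..n+1. a i * f (\<tau> i))"
    using gauss_rule_of_is_gauss[OF n Q] .
  then interpret gauss_rule n "{1..n+1}" a \<tau> by simp
  have "(4::nat) = Suc 3" by simp
  then have f': "f \<in> C01 (Suc 3)" "\<And>x. x \<in> {0..1} \<Longrightarrow> 0 \<le> deriv01 (Suc 3) f x"
    using f by metis+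
  have "0 \<le> (-1) ^ Suc 3 * M 3 t \<and> (-1) ^ Suc 3 * M 3 t \<le> 1 / (384 * real n ^ 4)"
    if "t \<in> {0..1}" for t
    using kernel_bounds[OF that] by simp
  note bounds = weighted_integral_bounds[OF f' this remainder_integral[OF f'(1)]]
  show "0 \<le> remainder Q f" using bounds(1) by (simp add: remainder_def Q_eq)
  show "remainder Q f \<le> 1 / (384 * real n ^ 4) * (deriv01 3 f 1 - deriv01 3 f 0)"
    using bounds(2) by (simp only: remainder_def Q_eq)
qed

end

theorem theorem2:
  shows "(\<forall>f \<in> C01 3. (\<forall>x\<in>{0..1}. 0 \<le> deriv01 3 f x) \<longrightarrow>
            (\<forall>n\<ge>2.
               (\<forall>Q. is_left_radau n Q \<longrightarrow>
                  0 \<le> remainder Q f \<and>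
                  remainder Q f \<le> sqrt 3 / (108 * real n ^ 3) * (deriv01 2 f 1 - deriv01 2 f 0)) \<and>
               (\<forall>Q. is_right_radau n Q \<longrightarrow>
                  0 \<ge> remainder Q f \<and>
                  remainder Q f \<ge> sqrt 3 / (108 * real n ^ 3) * (deriv01 2 f 0 - deriv01 2 f 1))))
       \<and> (\<forall>f \<in> C01 4. (\<forall>x\<in>{0..1}. 0 \<le> deriv01 4 f x) \<longrightarrow>
            (\<forall>n\<ge>2. \<forall>Q. is_gauss n Q \<longrightarrow>
               0 \<le> remainder Q f \<and>
               remainder Q f \<le> 1 / (384 * real n ^ 4) * (deriv01 3 f 1 - deriv01 3 f 0)))"
proof (rule conjI, goal_cases)
  case 1
  show ?case
    by (intro ballI impI allI conjI left_radau_bounds right_radau_bounds) auto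
next
  case 2
  show ?case
    by (intro ballI impI allI conjI gauss_bounds) auto
qed

end
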